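(* Let $n\ge 0$ be an integer, let $A_{n,2}=C_{n+1}\oplus A_2$ be the ordinal sum of a chain with $n+1$ elements and an antichain with $2$ elements, and let $H_n(x)$ be the $h$-polynomial of the poset associahedron $\mathscr{A}(A_{n,2})$. Then $H_n(x)$ is real-rooted, i.e. all of its (complex) zeros are real.
   Context: Posets. $C_m$ is the chain with $m$ elements and $A_k$ the antichain with $k$ elements. The ordinal sum $P\oplus Q$ has underlying set $P\sqcup Q$, with $a\le b$ iff ($a,b\in P$ and $a\le_P b$) or ($a,b\in Q$ and $a\le_Q b$) or ($a\in P$ and $b\in Q$). Poset associahedron. Let $(P,\preceq)$ be a finite connected poset. A subset $\tau\subseteq P$ is connected if it is connected as an induced subgraph of the Hasse diagram of $P$; it is convex if $x,z\in\tau$, $y\in P$, $x\preceq y\preceq z$ imply $y\in\tau$. A tube is a connected convex subset; it is proper if $1<|\tau|<|P|$. Two tubes are nested if one contains the other, and disjoint if their intersection is empty. Write $\sigma\prec\tau$ if $\sigma\cap\tau=\emptyset$ and there are $x\in\sigma$, $y\in\tau$ with $x\preceq y$. A tubing is a set $T$ of proper tubes, any two of which are nested or disjoint, such that there is no subset $\{\tau_1,\ldots,\tau_m\}\subseteq T$ with $\tau_1\prec\tau_2\prec\cdots\prec\tau_m\prec\tau_1$. The poset associahedron $\mathscr{A}(P)$ is a simple convex polytope of dimension $|P|-2$ (it exists by a theorem of Galashin) whose face lattice is the set of tubings of $P$ ordered by reverse inclusion; a tubing with $j$ tubes corresponds to a face of dimension $|P|-2-j$. Face numbers. For a $d$-dimensional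 simple polytope with $f_i$ faces of dimension $i$ ($0\le i\le d$), the $f$-polynomial is $f(t)=\sum_{i=0}^d f_it^i$, and the $h$-polynomial $h(t)=\sum_{i=0}^d h_it^i$ is defined by $f(t)=h(t+1)$. *)

theory Defs
  imports "HOL-Analysis.Polytope" "HOL-Computational_Algebra.Polynomial"
begin

section \<open>Finite posets\<close>

text \<open>A poset is given by its reflexive order relation \<open>r\<close>; its underlying set is \<open>Field r\<close>.\<close>

definition chain_poset :: "nat \<Rightarrow> nat rel" where
  "chain_poset m = {(i, j). i < m \<and> j < m \<and> i \<le> j}"

definition antichain_poset :: "nat \<Rightarrow> nat rel" where
  "antichain_poset k = Id_on {..<k}"

definition ordinal_sum :: "'a rel \<Rightarrow> 'b rel \<Rightarrow> ('a + 'b) rel" where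
  "ordinal_sum r s =
     {(Inl a, Inl b) | a b. (a, b) \<in> r} \<union>
     {(Inr a, Inr b) | a b. (a, b) \<in> s} \<union>
     {(Inl a, Inr b) | a b. a \<in> Field r \<and> b \<in> Field s}"

definition A_poset :: "nat \<Rightarrow> nat \<Rightarrow> (nat + nat) rel" where
  "A_poset n k = ordinal_sum (chain_poset (n + 1)) (antichain_poset k)"

definition covers :: "'a rel \<Rightarrow> 'a \<Rightarrow> 'a \<Rightarrow> bool" where
  "covers r x y \<longleftrightarrow> (x, y) \<in> r \<and> x \<noteq> y \<and>
     \<not> (\<exists>z. z \<noteq> x \<and> z \<noteq> y \<and> (x, z) \<in> r \<and> (z, y) \<in> r)"

definition hasse_edges :: "'a rel \<Rightarrow> 'a rel" where
  "hasse_edges r = {(x, y). covers r x y \<or> covers r y x}"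

definition hasse_connected :: "'a rel \<Rightarrow> 'a set \<Rightarrow> bool" where
  "hasse_connected r \<tau> \<longleftrightarrow>
     (\<forall>x\<in>\<tau>. \<forall>y\<in>\<tau>. (x, y) \<in> (hasse_edges r \<inter> \<tau> \<times> \<tau>)\<^sup>*)"

definition order_convex :: "'a rel \<Rightarrow> 'a set \<Rightarrow> bool" where
  "order_convex r \<tau> \<longleftrightarrow>
     (\<forall>x\<in>\<tau>. \<forall>z\<in>\<tau>. \<forall>y\<in>Field r. (x, y) \<in> r \<longrightarrow> (y, z) \<in> r \<longrightarrow> y \<in> \<tau>)"

section \<open>Tubings\<close>

definition tube :: "'a rel \<Rightarrow> 'a set \<Rightarrow> bool" where
  "tube r \<tau> \<longleftrightarrow> \<tau> \<subseteq> Field r \<and> hasse_connected r \<tau> \<and> order_convex r \<tau>"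

definition proper_tube :: "'a rel \<Rightarrow> 'a set \<Rightarrow> bool" where
  "proper_tube r \<tau> \<longleftrightarrow> tube r \<tau> \<and> 1 < card \<tau> \<and> card \<tau> < card (Field r)"

definition nested :: "'a set \<Rightarrow> 'a set \<Rightarrow> bool" where
  "nested \<sigma> \<tau> \<longleftrightarrow> \<sigma> \<subseteq> \<tau> \<or> \<tau> \<subseteq> \<sigma>"

definition tube_prec :: "'a rel \<Rightarrow> 'a set \<Rightarrow> 'a set \<Rightarrow> bool" where
  "tube_prec r \<sigma> \<tau> \<longleftrightarrow> \<sigma> \<inter> \<tau> = {} \<and> (\<exists>x\<in>\<sigma>. \<exists>y\<in>\<tau>. (x, y) \<in> r)"

text \<open>The last conjunct says that no \<open>\<tau>\<^sub>1, \<dots>, \<tau>\<^sub>m \<in> T\<close> satisfy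
  \<open>\<tau>\<^sub>1 \<prec> \<tau>\<^sub>2 \<prec> \<dots> \<prec> \<tau>\<^sub>m \<prec> \<tau>\<^sub>1\<close>.\<close>

definition tubing :: "'a rel \<Rightarrow> 'a set set \<Rightarrow> bool" where
  "tubing r T \<longleftrightarrow>
     (\<forall>\<tau>\<in>T. proper_tube r \<tau>) \<and>
     (\<forall>\<sigma>\<in>T. \<forall>\<tau>\<in>T. nested \<sigma> \<tau> \<or> \<sigma> \<inter> \<tau> = {}) \<and>
     acyclic {(\<sigma>, \<tau>). \<sigma> \<in> T \<and> \<tau> \<in> T \<and> tube_prec r \<sigma> \<tau>}"

section \<open>Poset associahedra\<close>

definition simple_polytope :: "'e::euclidean_space set \<Rightarrow> bool" where
  "simple_polytope S \<longleftrightarrow> polytope S \<and>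
     (\<forall>v. v extreme_point_of S \<longrightarrow> int (card {F. F facet_of S \<and> v \<in> F}) = aff_dim S)"

text \<open>Poset associahedra are determined only up to combinatorial equivalence, so being one is a
  predicate on polytopes. The empty face, the bottom of the face lattice, corresponds to no
  tubing; the empty tubing corresponds to the whole polytope.\<close>

definition poset_associahedron :: "'a rel \<Rightarrow> 'e::euclidean_space set \<Rightarrow> bool" where
  "poset_associahedron r S \<longleftrightarrow>
     simple_polytope S \<and>
     aff_dim S = int (card (Field r)) - 2 \<and>
     (\<exists>\<phi>. bij_betw \<phi> {T. tubing r T} {F. F face_of S \<and> F \<noteq> {}} \<and>
          (\<forall>T T'. tubing r T \<longrightarrow> tubing r T' \<longrightarrow> (\<phi> T \<subseteq> \<phi> T' \<longleftrightarrow> T' \<subseteq> T)) \<and>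
          (\<forall>T. tubing r T \<longrightarrow> aff_dim (\<phi> T) = int (card (Field r)) - 2 - int (card T)))"

section \<open>Face polynomials\<close>

definition f_polynomial :: "'e::euclidean_space set \<Rightarrow> real poly" where
  "f_polynomial S =
     (\<Sum>i\<le>nat (aff_dim S). monom (of_nat (card {F. F face_of S \<and> aff_dim F = int i})) i)"

definition h_polynomial :: "'e::euclidean_space set \<Rightarrow> real poly" where
  "h_polynomial S = (THE h. f_polynomial S = pcompose h [:1, 1:])"

lemma h_polynomial_iff:
  "h = h_polynomial S \<longleftrightarrow> f_polynomial S = pcompose h [:1, 1:]"
proof -
  have inv: "pcompose (pcompose h [:1, 1:]) [:-1, 1:] = h" for h :: "real poly"
    by (simp add: pcompose_assoc[symmetric] pcompose_pCons pcompose_idR)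
  have inv': "pcompose (pcompose h [:-1, 1:]) [:1, 1:] = h" for h :: "real poly"
    by (simp add: pcompose_assoc[symmetric] pcompose_pCons pcompose_idR)
  have "\<exists>!h. f_polynomial S = pcompose h [:1, 1:]"
    by (metis inv inv')
  from theI'[OF this] the1_equality[OF this] show ?thesis
    unfolding h_polynomial_def by blast
qed

definition real_rooted :: "real poly \<Rightarrow> bool" where
  "real_rooted p \<longleftrightarrow> (\<forall>z::complex. poly (map_poly complex_of_real p) z = 0 \<longrightarrow> z \<in> \<real>)"

section \<open>The posets are finite, connected and partially ordered\<close>

lemma Field_chain_poset: "Field (chain_poset m) = {..<m}"
  by (auto simp: chain_poset_def Field_def)

lemma Field_antichain_poset: "Field (antichain_poset k) = {..<k}"
  by (auto simp: antichain_poset_def Field_def)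

lemma Field_A_poset: "Field (A_poset n k) = {..<n + 1} <+> {..<k}"
  unfolding A_poset_def ordinal_sum_def Field_chain_poset Field_antichain_poset
  by (fastforce simp: chain_poset_def antichain_poset_def Field_def Plus_def)

lemma card_Field_A_poset: "finite (Field (A_poset n k))" "card (Field (A_poset n k)) = n + 1 + k"
  by (auto simp: Field_A_poset card_Plus)

lemma A_poset_iff:
  "(Inl i, Inl j) \<in> A_poset n k \<longleftrightarrow> i \<le> j \<and> j \<le> n"
  "(Inl i, Inr l) \<in> A_poset n k \<longleftrightarrow> i \<le> n \<and> l < k"
  "(Inr l, Inl i) \<notin> A_poset n k"
  "(Inr l, Inr m) \<in> A_poset n k \<longleftrightarrow> l = m \<and> l < k"
  unfolding A_poset_def ordinal_sum_def Field_chain_poset Field_antichain_poset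
  by (auto simp: chain_poset_def antichain_poset_def)

lemma partial_order_A_poset: "Partial_order (A_poset n k)"
proof -
  have "refl_on (Field (A_poset n k)) (A_poset n k)"
    unfolding refl_on_def by (auto simp: Field_A_poset A_poset_iff)
  moreover have "trans (A_poset n k)"
  proof (rule transI)
    fix x y z
    assume "(x, y) \<in> A_poset n k" "(y, z) \<in> A_poset n k"
    then show "(x, z) \<in> A_poset n k"
      by (cases x; cases y; cases z) (auto simp: A_poset_iff)
  qed
  moreover have "antisym (A_poset n k)"
  proof (rule antisymI)
    fix x y
    assume "(x, y) \<in> A_poset n k" "(y, x) \<in> A_poset n k"
    then show "x = y"
      by (cases x; cases y) (auto simp: A_poset_iff)
  qed
  ultimately show ?thesis
    by (auto simp: order_on_defs Field_def)
qed

lemma connected_A_poset: "hasse_connected (A_poset n k) (Field (A_poset n k))"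
proof -
  let ?F = "Field (A_poset n k)"
  let ?E = "hasse_edges (A_poset n k) \<inter> ?F \<times> ?F"
  have sy: "sym ?E" by (auto simp: sym_def hasse_edges_def)
  note mem = A_poset_iff
  have ch: "(Inl 0, Inl i) \<in> ?E\<^sup>*" if "i \<le> n" for i
    using that
  proof (induction i)
    case (Suc i)
    have gap: "\<not> (z \<noteq> Inl i \<and> z \<noteq> Inl (Suc i) \<and> (Inl i, z) \<in> A_poset n k \<and>
        (z, Inl (Suc i)) \<in> A_poset n k)" for z
      by (cases z) (auto simp: mem)
    have "covers (A_poset n k) (Inl i) (Inl (Suc i))"
      using Suc.prems gap unfolding covers_def by (simp add: mem)
    then have "(Inl i, Inl (Suc i)) \<in> ?E"
      using Suc.prems by (auto simp: hasse_edges_def Field_A_poset)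
    with Suc show ?case by (meson Suc_leD rtrancl.rtrancl_into_rtrancl)
  qed simp
  have "(Inl 0, x) \<in> ?E\<^sup>*" if x: "x \<in> ?F" for x
  proof (cases x)
    case (Inl i)
    with x show ?thesis using ch by (auto simp: Field_A_poset)
  next
    case (Inr l)
    with x have l: "l < k" by (auto simp: Field_A_poset)
    have "\<not> (z \<noteq> Inl n \<and> z \<noteq> Inr l \<and> (Inl n, z) \<in> A_poset n k \<and> (z, Inr l) \<in> A_poset n k)" for z
      by (cases z) (auto simp: mem)
    then have "covers (A_poset n k) (Inl n) (Inr l)"
      using l unfolding covers_def by (auto simp: mem)
    then have "(Inl n, x) \<in> ?E"
      using l Inr by (auto simp: hasse_edges_def Field_A_poset)
    with ch[of n] show ?thesis by (meson order_refl rtrancl.rtrancl_into_rtrancl)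
  qed
  moreover from this have "(x, Inl 0) \<in> ?E\<^sup>*" if "x \<in> ?F" for x
    using symD[OF sym_rtrancl[OF sy]] that by blast
  ultimately show ?thesis
    unfolding hasse_connected_def by (blast intro: rtrancl_trans)
qed

end

theory Submission
  imports Defs "HOL-Computational_Algebra.Formal_Power_Series"
begin

text \<open>
  Let \<open>V\<^sub>m(y)\<close> be the sum of \<open>y\<close> to the number of tubes over all tubings of the poset with a chain of
  \<open>m\<close> elements below two incomparable ones. Since tubings with \<open>j\<close> tubes are faces of
  codimension \<open>j\<close>, and the \<open>h\<close>-polynomial at \<open>z\<close> is the \<open>f\<close>-polynomial at \<open>t = z - 1\<close>, we have
  \<open>H\<^sub>n(z) = t\<^bsup>n+1\<^esup> V\<^bsub>n+1\<^esub>(1/t)\<close> (lemma \<open>poly_f_polynomial\<close>). So it is enough that \<open>V\<^sub>m(y) \<noteq> 0\<close> for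
  every nonreal \<open>y\<close>.

  For this poset the condition on cycles is automatic, and a tubing is just a laminar family of
  proper tubes: any two are nested or disjoint (\<open>tubing_iff\<close>). Laminar families are enumerated by
  looking at their largest member through a fixed point (\<open>laminar_weight_split\<close>). With the bottom
  element as this point, everything strictly inside that member, and everything outside, is again
  a chain or a poset of the same kind. This gives convolution recurrences for \<open>V\<^sub>m\<close> and for the
  analogous weights \<open>D\<^sub>m\<close> of a chain of \<open>m\<close> elements that is itself a tube (\<open>chain_weight_Suc\<close>,
  \<open>tubing_weight_Suc\<close>).

  In terms of generating functions, \<open>D(X)\<close> is the root of a quadratic equation whose discriminant is
  \<open>1 - 2 u X + X\<^sup>2\<close> with \<open>u = 1 + 2 y\<close>, the quadratic polynomial behind the Legendre polynomials. Two
  consequences follow: a recurrence of three terms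
  \<open>(k + 3) D\<^bsub>k+3\<^esub> = (2 k + 3) u D\<^bsub>k+2\<^esub> - k D\<^bsub>k+1\<^esub>\<close> (\<open>block_weight_recurrence\<close>), and the formula
  \<open>y V\<^sub>m = 2 D\<^bsub>m+2\<^esub> - u D\<^bsub>m+1\<^esub>\<close> for \<open>m \<ge> 1\<close> (\<open>tubing_weight_closed_form\<close>).

  If \<open>u\<close> is nonreal, the recurrence shows by induction that every ratio \<open>r = D\<^bsub>k+3\<^esub> / D\<^bsub>k+2\<^esub>\<close> lies in
  the half-plane of \<open>u\<close>, at least as far from the real axis as \<open>u\<close>. Hence \<open>2 r - u\<close> is nonreal and
  \<open>V\<^sub>m\<close> does not vanish (\<open>nonreal_combination_nonzero\<close>).
\<close>

section \<open>Weighted enumeration of laminar families\<close>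

definition laminar :: "'a set set \<Rightarrow> bool" where
  "laminar T \<longleftrightarrow> (\<forall>\<sigma>\<in>T. \<forall>\<tau>\<in>T. nested \<sigma> \<tau> \<or> \<sigma> \<inter> \<tau> = {})"

definition laminar_weight :: "'b::comm_ring_1 \<Rightarrow> 'a set set \<Rightarrow> 'b" where
  "laminar_weight y U = (\<Sum>T | T \<subseteq> U \<and> laminar T. y ^ card T)"

lemma laminar_subset: "laminar T \<Longrightarrow> T' \<subseteq> T \<Longrightarrow> laminar T'"
  unfolding laminar_def by blast

lemma laminar_empty [simp]: "laminar {}"
  by (simp add: laminar_def)

lemma nested_or_disjoint_commute:
  "nested \<sigma> \<tau> \<or> \<sigma> \<inter> \<tau> = {} \<longleftrightarrow> nested \<tau> \<sigma> \<or> \<tau> \<inter> \<sigma> = {}"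
  by (auto simp: nested_def)

lemma laminar_Un:
  assumes "laminar S" "laminar T"
    and "\<And>\<sigma> \<tau>. \<sigma> \<in> S \<Longrightarrow> \<tau> \<in> T \<Longrightarrow> nested \<sigma> \<tau> \<or> \<sigma> \<inter> \<tau> = {}"
  shows "laminar (S \<union> T)"
  using assms nested_or_disjoint_commute unfolding laminar_def by (metis Un_iff)

lemma laminar_weight_empty [simp]: "laminar_weight y ({} :: 'a set set) = 1"
proof -
  have "{T :: 'a set set. T \<subseteq> {} \<and> laminar T} = {{}}" by auto
  then show ?thesis unfolding laminar_weight_def by (simp only:) simp
qed

lemma inj_on_image_subset_iff:
  assumes "inj_on f X" "A \<subseteq> X" "B \<subseteq> X"
  shows "f ` A \<subseteq> f ` B \<longleftrightarrow> A \<subseteq> B"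
proof -
  have "f x \<in> f ` B \<longleftrightarrow> x \<in> B" if "x \<in> A" for x
    using inj_on_image_mem_iff[OF assms(1) _ assms(3)] assms(2) that by blast
  then show ?thesis unfolding image_subset_iff by auto
qed

text \<open>This lets posets be compared by relabelling their elements: every family met below is a
  relabelled copy of one that lives on an initial segment.\<close>
lemma laminar_weight_transport:
  assumes inj: "inj_on f X" and U: "U \<subseteq> Pow X"
  shows "laminar_weight y ((`) f ` U) = laminar_weight y U"
proof -
  have injP: "inj_on ((`) f) U"
    using inj_on_image_Pow[OF inj] U by (rule inj_on_subset)
  have lam: "laminar ((`) f ` T) \<longleftrightarrow> laminar T" if "T \<subseteq> U" for T
  proof -
    have "nested (f ` \<sigma>) (f ` \<tau>) \<longleftrightarrow> nested \<sigma> \<tau>"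
      and "f ` \<sigma> \<inter> f ` \<tau> = {} \<longleftrightarrow> \<sigma> \<inter> \<tau> = {}" if "\<sigma> \<in> T" "\<tau> \<in> T" for \<sigma> \<tau>
    proof -
      have sub: "\<sigma> \<subseteq> X" "\<tau> \<subseteq> X" using that \<open>T \<subseteq> U\<close> U by auto
      show "nested (f ` \<sigma>) (f ` \<tau>) \<longleftrightarrow> nested \<sigma> \<tau>"
        unfolding nested_def using sub inj
        by (simp add: inj_on_image_subset_iff)
      show "f ` \<sigma> \<inter> f ` \<tau> = {} \<longleftrightarrow> \<sigma> \<inter> \<tau> = {}"
        using inj_on_image_Int[OF inj sub] by auto
    qed
    then show ?thesis unfolding laminar_def by auto
  qed
  have eq: "{T. T \<subseteq> (`) f ` U \<and> laminar T} = (`) ((`) f) ` {T. T \<subseteq> U \<and> laminar T}"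
  proof (intro equalityI subsetI)
    fix T assume "T \<in> {T. T \<subseteq> (`) f ` U \<and> laminar T}"
    moreover then obtain T' where "T' \<subseteq> U" "T = (`) f ` T'" by (auto elim: subset_imageE)
    ultimately show "T \<in> (`) ((`) f) ` {T. T \<subseteq> U \<and> laminar T}" using lam by auto
  qed (use lam in auto)
  have inj2: "inj_on ((`) ((`) f)) {T. T \<subseteq> U \<and> laminar T}"
    using inj_on_image_Pow[OF injP] by (rule inj_on_subset) auto
  have "card ((`) f ` T) = card T" if "T \<subseteq> U" for T
    using inj_on_subset[OF injP that] by (rule card_image)
  then show ?thesis
    unfolding laminar_weight_def eq by (subst sum.reindex[OF inj2]) (auto intro!: sum.cong)
qed

text \<open>A set that contains all the others is compatible with every family, so its presence is a free
  choice.\<close>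
lemma laminar_weight_greatest:
  assumes fin: "finite U" and X: "X \<in> U" and sub: "\<And>B. B \<in> U \<Longrightarrow> B \<subseteq> X"
  shows "laminar_weight y U = (1 + y) * laminar_weight y (U - {X})"
proof -
  let ?L = "{T. T \<subseteq> U - {X} \<and> laminar T}"
  have lam: "laminar (insert X T)" if "T \<subseteq> U" "laminar T" for T
    using that sub unfolding laminar_def nested_def by blast
  have "{T. T \<subseteq> U \<and> laminar T} = ?L \<union> insert X ` ?L"
  proof (intro equalityI subsetI)
    fix T assume T: "T \<in> {T. T \<subseteq> U \<and> laminar T}"
    show "T \<in> ?L \<union> insert X ` ?L"
    proof (cases "X \<in> T")
      case True
      then have "T = insert X (T - {X})" by auto
      moreover have "T - {X} \<in> ?L" using T laminar_subset[of T "T - {X}"] by auto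
      ultimately show ?thesis by blast
    qed (use T in auto)
  qed (use X lam in auto)
  moreover have "?L \<inter> insert X ` ?L = {}" by auto
  moreover have "finite ?L" using fin by (auto intro: finite_subset[of _ "Pow U"])
  moreover have "inj_on (insert X) ?L" by (rule inj_onI) (auto simp: insert_ident)
  moreover have "card (insert X T) = Suc (card T)" if "T \<in> ?L" for T
    using that fin by (subst card_insert_disjoint) (auto intro: finite_subset[of _ U])
  ultimately have "laminar_weight y U = (\<Sum>T\<in>?L. y ^ card T) + (\<Sum>T\<in>?L. y ^ Suc (card T))"
    unfolding laminar_weight_def by (simp add: sum.union_disjoint sum.reindex)
  then show ?thesis
    unfolding laminar_weight_def by (simp add: sum_distrib_left distrib_right sum.distrib)
qed

text \<open>The members of a laminar family that contain \<open>p\<close> form a chain under inclusion. If there are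
  any, let \<open>A\<close> be the largest; every other member is then either strictly inside \<open>A\<close> or disjoint
  from it, and the two parts can be chosen independently of each other.\<close>
lemma laminar_weight_split:
  assumes fin: "finite U" and ne: "{} \<notin> U"
  shows "laminar_weight y U = laminar_weight y {B\<in>U. p \<notin> B} +
    (\<Sum>A | A \<in> U \<and> p \<in> A. y * laminar_weight y {B\<in>U. B \<subset> A} * laminar_weight y {B\<in>U. B \<inter> A = {}})"
proof -
  define L where "L V = {T. T \<subseteq> V \<and> laminar T}" for V :: "'a set set"
  define below where "below A = {B\<in>U. B \<subset> A}" for A
  define apart where "apart A = {B\<in>U. B \<inter> A = {}}" for A
  define S where "S = (SIGMA A : {A. A \<in> U \<and> p \<in> A}. L (below A) \<times> L (apart A))"
  \<comment> \<open>the union of a chain of sets with a largest element is that element\<close>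
  define R where "R T = \<Union>{B\<in>T. p \<in> B}" for T
  have finL: "finite (L V)" if "V \<subseteq> U" for V
    using that fin unfolding L_def by (auto intro: finite_subset[of _ "Pow U"])
  have R: "R T \<in> T" "p \<in> R T" "\<And>B. B \<in> T \<Longrightarrow> B = R T \<or> B \<subset> R T \<or> B \<inter> R T = {}"
    if T: "T \<subseteq> U" "laminar T" and p: "\<not> T \<subseteq> {B\<in>U. p \<notin> B}" for T
  proof -
    let ?M = "{B\<in>T. p \<in> B}"
    have "finite ?M" "?M \<noteq> {}" using T p fin by (auto intro: finite_subset)
    then obtain A where A: "A \<in> ?M" and "\<forall>B\<in>?M. A \<subseteq> B \<longrightarrow> A = B"
      using finite_has_maximal[of ?M] by blast
    then have max: "B = A" if "B \<in> T" "p \<in> B" "A \<subseteq> B" for B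
      using that by blast
    have sub: "B \<subseteq> A" if "B \<in> ?M" for B
    proof -
      have "nested A B \<or> A \<inter> B = {}" using A that T(2) unfolding laminar_def by simp
      then show ?thesis using A that max[of B] unfolding nested_def by auto
    qed
    then have eq: "R T = A" unfolding R_def using A by auto
    show "R T \<in> T" "p \<in> R T" using A eq by auto
    show "B = R T \<or> B \<subset> R T \<or> B \<inter> R T = {}" if "B \<in> T" for B
    proof (cases "p \<in> B")
      case True
      then show ?thesis using sub[of B] that eq by auto
    next
      case False
      have "nested A B \<or> A \<inter> B = {}" using A that T(2) unfolding laminar_def by simp
      then show ?thesis using A False unfolding nested_def eq by auto
    qed
  qed
  have "laminar_weight y U = (\<Sum>T\<in>L {B\<in>U. p \<notin> B}. y ^ card T) + (\<Sum>T\<in>L U - L {B\<in>U. p \<notin> B}. y ^ card T)"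
    unfolding laminar_weight_def L_def[symmetric]
    by (subst sum.subset_diff[of "L {B\<in>U. p \<notin> B}"]) (auto simp: L_def add.commute fin)
  also have "(\<Sum>T\<in>L U - L {B\<in>U. p \<notin> B}. y ^ card T) =
      (\<Sum>(A, T1, T2)\<in>S. y * y ^ card T1 * y ^ card T2)"
  proof (rule sum.reindex_bij_witness[where
        i = "\<lambda>(A, T1, T2). insert A (T1 \<union> T2)" and
        j = "\<lambda>T. (R T, {B\<in>T. B \<subset> R T}, {B\<in>T. B \<inter> R T = {}})"])
    fix T assume "T \<in> L U - L {B\<in>U. p \<notin> B}"
    then have T: "T \<subseteq> U" "laminar T" "\<not> T \<subseteq> {B\<in>U. p \<notin> B}" by (auto simp: L_def)
    note RT = R[OF T]
    show *: "(case (R T, {B\<in>T. B \<subset> R T}, {B\<in>T. B \<inter> R T = {}}) of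
        (A, T1, T2) \<Rightarrow> insert A (T1 \<union> T2)) = T"
      using RT by auto
    show "(R T, {B\<in>T. B \<subset> R T}, {B\<in>T. B \<inter> R T = {}}) \<in> S"
      using RT T by (auto simp: S_def L_def below_def apart_def intro: laminar_subset)
    have finT: "finite T" using T fin by (auto intro: finite_subset)
    have "card T = card (insert (R T) ({B\<in>T. B \<subset> R T} \<union> {B\<in>T. B \<inter> R T = {}}))"
      using * by simp
    also have "\<dots> = Suc (card ({B\<in>T. B \<subset> R T} \<union> {B\<in>T. B \<inter> R T = {}}))"
      by (subst card_insert_disjoint) (use finT RT in auto)
    also have "card ({B\<in>T. B \<subset> R T} \<union> {B\<in>T. B \<inter> R T = {}}) =
        card {B\<in>T. B \<subset> R T} + card {B\<in>T. B \<inter> R T = {}}"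
    proof (rule card_Un_disjoint)
      have "B \<noteq> {}" if "B \<in> T" for B using that ne T by auto
      then show "{B\<in>T. B \<subset> R T} \<inter> {B\<in>T. B \<inter> R T = {}} = {}" by blast
    qed (use finT in auto)
    finally show "(case (R T, {B\<in>T. B \<subset> R T}, {B\<in>T. B \<inter> R T = {}}) of
        (A, T1, T2) \<Rightarrow> y * y ^ card T1 * y ^ card T2) = y ^ card T"
      by (simp add: power_add mult.assoc)
  next
    fix s assume "s \<in> S"
    then obtain A T1 T2 where s: "s = (A, T1, T2)" and A: "A \<in> U" "p \<in> A"
      and T1: "T1 \<subseteq> below A" "laminar T1" and T2: "T2 \<subseteq> apart A" "laminar T2"
      by (auto simp: S_def L_def)
    let ?T = "insert A (T1 \<union> T2)"
    have R: "R ?T = A"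
      unfolding R_def using A T1 T2 by (auto simp: below_def apart_def)
    have below: "B \<subset> A \<and> B \<inter> A \<noteq> {}" if "B \<in> T1" for B
    proof -
      have "B \<subset> A" "B \<noteq> {}" using that T1 ne by (auto simp: below_def)
      then show ?thesis by blast
    qed
    have apart: "\<not> B \<subset> A \<and> B \<inter> A = {}" if "B \<in> T2" for B
    proof -
      have "B \<inter> A = {}" "B \<noteq> {}" using that T2 ne by (auto simp: apart_def)
      then show ?thesis by blast
    qed
    have eq1: "{B\<in>?T. B \<subset> A} = T1"
      using below apart by blast
    have eq2: "{B\<in>?T. B \<inter> A = {}} = T2"
      using below apart A by blast
    show "(case s of (A, T1, T2) \<Rightarrow> insert A (T1 \<union> T2)) \<in> L U - L {B\<in>U. p \<notin> B}"
    proof -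
      have cross: "\<sigma> \<inter> \<tau> = {}" if "\<sigma> \<in> T1" "\<tau> \<in> T2" for \<sigma> \<tau>
        using that T1 T2 by (auto simp: below_def apart_def)
      have "laminar ({A} \<union> (T1 \<union> T2))"
      proof (intro laminar_Un T1(2) T2(2))
        show "laminar {A}" by (simp add: laminar_def nested_def)
        show "nested \<sigma> \<tau> \<or> \<sigma> \<inter> \<tau> = {}" if "\<sigma> \<in> T1" "\<tau> \<in> T2" for \<sigma> \<tau>
          using cross that by blast
        show "nested \<sigma> \<tau> \<or> \<sigma> \<inter> \<tau> = {}" if "\<sigma> \<in> {A}" "\<tau> \<in> T1 \<union> T2" for \<sigma> \<tau>
          using that below[of \<tau>] apart[of \<tau>] by (auto simp: nested_def)
      qed
      then show ?thesis
        using A T1 T2 by (auto simp: L_def s below_def apart_def)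
    qed
    show "(\<lambda>T. (R T, {B\<in>T. B \<subset> R T}, {B\<in>T. B \<inter> R T = {}}))
        (case s of (A, T1, T2) \<Rightarrow> insert A (T1 \<union> T2)) = s"
      unfolding s prod.case R eq1 eq2 ..
  qed
  also have "\<dots> = (\<Sum>A | A \<in> U \<and> p \<in> A. \<Sum>(T1, T2)\<in>L (below A) \<times> L (apart A).
      y * y ^ card T1 * y ^ card T2)"
    unfolding S_def
    by (subst sum.Sigma[symmetric]) (auto simp: fin finL below_def apart_def)
  also have "\<dots> = (\<Sum>A | A \<in> U \<and> p \<in> A.
      y * laminar_weight y (below A) * laminar_weight y (apart A))"
    unfolding laminar_weight_def L_def[symmetric] sum.cartesian_product[symmetric]
    by (simp add: sum_distrib_left sum_distrib_right mult.assoc) (rule sum.cong[OF refl], rule sum.swap)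
  finally show ?thesis
    by (simp add: laminar_weight_def L_def below_def apart_def)
qed

section \<open>Laminar families of intervals of a chain\<close>

definition intervals :: "nat \<Rightarrow> nat set set" where
  "intervals m = {{a..b} | a b. a < b \<and> b < m}"

definition chain_weight :: "'b::comm_ring_1 \<Rightarrow> nat \<Rightarrow> 'b" where
  "chain_weight y m = laminar_weight y (intervals m)"

text \<open>Cut a chain into the maximal members of a laminar family and the points that no member covers.
  A block is one of these pieces with everything inside it: a single point has weight 1, and an
  interval of length at least 2 is itself a member, which gives the factor \<open>y\<close>.\<close>
definition block_weight :: "'b::comm_ring_1 \<Rightarrow> nat \<Rightarrow> 'b" where
  "block_weight y m =
     (if m = 0 then 0 else if m = 1 then 1 else y * laminar_weight y (intervals m - {{..<m}}))"

lemma intervalsI: "a < b \<Longrightarrow> b < m \<Longrightarrow> {a..b} \<in> intervals m"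
  by (auto simp: intervals_def)

lemma intervalsE:
  assumes "B \<in> intervals m"
  obtains a b where "B = {a..b}" "a < b" "b < m"
  using assms by (auto simp: intervals_def)

lemma intervals_subset_Pow: "intervals m \<subseteq> Pow {..<m}"
  by (auto simp: intervals_def)

lemma empty_notin_intervals: "{} \<notin> intervals m"
  by (auto elim!: intervalsE)

lemma finite_intervals: "finite (intervals m)"
  using intervals_subset_Pow by (rule finite_subset) simp

text \<open>Adjoining the whole chain to a family that omits it gives a block.\<close>
lemma block_weight_conv_chain_weight:
  assumes "m \<ge> 2"
  shows "block_weight y m = y * (chain_weight y m - block_weight y m)"
proof -
  have "{0..m - 1} \<in> intervals m" using assms by (intro intervalsI) auto
  moreover have "{0..m - 1} = {..<m}" using assms by auto
  ultimately have "{..<m} \<in> intervals m" by (simp only:)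
  then have "chain_weight y m = (1 + y) * laminar_weight y (intervals m - {{..<m}})"
    unfolding chain_weight_def using intervals_subset_Pow
    by (intro laminar_weight_greatest finite_intervals) auto
  then show ?thesis using assms by (simp add: block_weight_def algebra_simps)
qed

lemma image_intervals: "{g ` {a..b} | a b. a < b \<and> b < m} = (`) g ` intervals m"
  unfolding intervals_def by auto

lemma chain_weight_transport:
  assumes "inj_on g {..<m}"
  shows "laminar_weight y {g ` {a..b} | a b. a < b \<and> b < m} = chain_weight y m"
  unfolding image_intervals chain_weight_def
  by (rule laminar_weight_transport[OF assms intervals_subset_Pow])

lemma block_weight_transport:
  assumes g: "inj_on g {..<m}" and m: "m \<ge> 2"
  shows "y * laminar_weight y ({g ` {a..b} | a b. a < b \<and> b < m} - {g ` {..<m}}) = block_weight y m"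
proof -
  have injP: "inj_on ((`) g) (Pow {..<m})" using g by (rule inj_on_image_Pow)
  have "(`) g ` (intervals m - {{..<m}}) = (`) g ` intervals m - (`) g ` {{..<m}}"
    by (rule inj_on_image_set_diff[OF injP]) (use intervals_subset_Pow in auto)
  moreover have "laminar_weight y ((`) g ` (intervals m - {{..<m}})) = laminar_weight y (intervals m - {{..<m}})"
    by (rule laminar_weight_transport[OF g]) (use intervals_subset_Pow in auto)
  ultimately show ?thesis
    unfolding image_intervals using m by (simp add: block_weight_def)
qed

text \<open>Separates a first block that is a single point from a first block that is an interval.\<close>
lemma sum_first_block:
  fixes f :: "nat \<Rightarrow> 'a::comm_monoid_add"
  shows "(\<Sum>k=1..Suc m. f k) = f 1 + (\<Sum>b=1..m. f (Suc b))"
proof -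
  have "(\<Sum>k=1..Suc m. f k) = f 1 + (\<Sum>k=Suc 1..Suc m. f k)"
    by (rule sum.atLeast_Suc_atMost) simp
  also have "(\<Sum>k=Suc 1..Suc m. f k) = (\<Sum>b=1..m. f (Suc b))"
    by (rule sum.shift_bounds_cl_Suc_ivl)
  finally show ?thesis .
qed

text \<open>The block that contains the bottom element is an initial segment, and the families on the rest
  of the chain are those of a shorter chain.\<close>
lemma chain_weight_Suc:
  "chain_weight y (Suc m) = (\<Sum>k=1..Suc m. block_weight y k * chain_weight y (Suc m - k))"
proof -
  let ?U = "intervals (Suc m)"
  have "{B\<in>?U. 0 \<notin> B} = {Suc ` {a..b} | a b. a < b \<and> b < m}"
  proof (intro equalityI subsetI)
    fix B assume "B \<in> {B\<in>?U. 0 \<notin> B}"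
    then have "B \<in> ?U" "0 \<notin> B" by auto
    then obtain a b where ab: "B = {a..b}" "a < b" "b < Suc m" "0 \<notin> {a..b}" by (auto elim!: intervalsE)
    then obtain a' b' where "a = Suc a'" "b = Suc b'" by (cases a; cases b) auto
    with ab have "B = Suc ` {a'..b'}" "a' < b'" "b' < m" by (auto simp: image_Suc_atLeastAtMost)
    then show "B \<in> {Suc ` {a..b} | a b. a < b \<and> b < m}" by blast
  next
    fix B assume "B \<in> {Suc ` {a..b} | a b. a < b \<and> b < m}"
    then obtain a b where "B = {Suc a..Suc b}" "a < b" "b < m"
      by (auto simp: image_Suc_atLeastAtMost)
    then show "B \<in> {B\<in>?U. 0 \<notin> B}" by (auto intro: intervalsI)
  qed
  \<comment> \<open>these families supply the summand of index one, the block that consists of the point 0\<close>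
  then have without: "laminar_weight y {B\<in>?U. 0 \<notin> B} = chain_weight y m"
    by (simp only: chain_weight_transport[of Suc m y] inj_Suc)
  have first: "{A. A \<in> ?U \<and> 0 \<in> A} = (\<lambda>b. {0..b}) ` {1..m}"
    by (auto elim!: intervalsE intro: intervalsI)
  have inj: "inj_on (\<lambda>b::nat. {0..b}) {1..m}"
    by (rule inj_onI) simp
  have summand: "y * laminar_weight y {B\<in>?U. B \<subset> {0..b}} * laminar_weight y {B\<in>?U. B \<inter> {0..b} = {}}
      = block_weight y (Suc b) * chain_weight y (Suc m - Suc b)" if b: "b \<in> {1..m}" for b
  proof -
    have below: "{B\<in>?U. B \<subset> {0..b}} = intervals (Suc b) - {{..<Suc b}}"
    proof (intro equalityI subsetI)
      fix B assume "B \<in> {B\<in>?U. B \<subset> {0..b}}"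
      then have "B \<in> ?U" "B \<subset> {0..b}" by auto
      then obtain a' b' where ab: "B = {a'..b'}" "a' < b'" and sub: "{a'..b'} \<subset> {0..b}"
        by (auto elim!: intervalsE)
      have "b' \<in> {a'..b'}" using ab by simp
      then have "b' \<le> b" using sub by auto
      then have "B \<in> intervals (Suc b)" using ab by (auto intro: intervalsI)
      moreover have "B \<noteq> {..<Suc b}" using sub ab by (simp add: lessThan_Suc_atMost atLeast0AtMost)
      ultimately show "B \<in> intervals (Suc b) - {{..<Suc b}}" by simp
    next
      fix B assume "B \<in> intervals (Suc b) - {{..<Suc b}}"
      then have "B \<in> intervals (Suc b)" "B \<noteq> {..<Suc b}" by auto
      moreover then obtain a' b' where ab: "B = {a'..b'}" "a' < b'" "b' < Suc b" by (auto elim!: intervalsE)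
      ultimately show "B \<in> {B\<in>?U. B \<subset> {0..b}}"
        using b by (auto simp: lessThan_Suc_atMost atLeast0AtMost intro!: intervalsI)
    qed
    have apart: "{B\<in>?U. B \<inter> {0..b} = {}} = {(\<lambda>i. i + Suc b) ` {a'..b'} | a' b'. a' < b' \<and> b' < m - b}"
    proof (intro equalityI subsetI)
      fix B assume "B \<in> {B\<in>?U. B \<inter> {0..b} = {}}"
      then have "B \<in> ?U" "B \<inter> {0..b} = {}" by auto
      then obtain a' b' where ab: "B = {a'..b'}" "a' < b'" "b' < Suc m" and dis: "{a'..b'} \<inter> {0..b} = {}"
        by (auto elim!: intervalsE)
      have "a' \<in> {a'..b'}" using ab by simp
      then have "b < a'" using dis by (metis atLeastAtMost_iff disjoint_iff not_le zero_le)
      then have "B = (\<lambda>i. i + Suc b) ` {a' - Suc b..b' - Suc b}"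
        "a' - Suc b < b' - Suc b" "b' - Suc b < m - b"
        using ab unfolding image_add_atLeastAtMost' by auto
      then show "B \<in> {(\<lambda>i. i + Suc b) ` {a'..b'} | a' b'. a' < b' \<and> b' < m - b}"
        by blast
    next
      fix B assume "B \<in> {(\<lambda>i. i + Suc b) ` {a'..b'} | a' b'. a' < b' \<and> b' < m - b}"
      then obtain a' b' where "B = (\<lambda>i. i + Suc b) ` {a'..b'}" "a' < b'" "b' < m - b" by blast
      then show "B \<in> {B\<in>?U. B \<inter> {0..b} = {}}"
        unfolding image_add_atLeastAtMost' by (auto intro: intervalsI)
    qed
    have "laminar_weight y {B\<in>?U. B \<inter> {0..b} = {}} = chain_weight y (m - b)"
      unfolding apart by (rule chain_weight_transport) (simp add: inj_on_def)
    then show ?thesis using b unfolding below by (simp add: block_weight_def)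
  qed
  have "chain_weight y (Suc m) = chain_weight y m +
      (\<Sum>A\<in>(\<lambda>b. {0..b}) ` {1..m}. y * laminar_weight y {B\<in>?U. B \<subset> A} * laminar_weight y {B\<in>?U. B \<inter> A = {}})"
    unfolding chain_weight_def first[symmetric] without[unfolded chain_weight_def, symmetric]
    by (rule laminar_weight_split) (simp_all add: finite_intervals empty_notin_intervals)
  also have "\<dots> = chain_weight y m + (\<Sum>b=1..m. block_weight y (Suc b) * chain_weight y (Suc m - Suc b))"
    unfolding sum.reindex[OF inj] o_def
    by (rule arg_cong[where f = "(+) (chain_weight y m)"], rule sum.cong[OF refl summand])
  finally show ?thesis unfolding sum_first_block by (simp add: block_weight_def)
qed

section \<open>Generating functions\<close>

unbundle no vec_syntax
unbundle fps_syntax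

text \<open>The square root \<open>s\<close> of the discriminant satisfies \<open>s\<^sup>2 = 1 - 2 u X + X\<^sup>2\<close> with \<open>u = 1 + 2 y\<close>. Since
  \<open>1/s\<close> is the generating function of the Legendre polynomials in \<open>u\<close>, the coefficients of \<open>s\<close>, and
  with them those of \<open>D\<close>, obey a recurrence of three terms. It is read off from the first-order
  differential equation of \<open>s\<close>.\<close>
lemma quadratic_coeff_recurrence:
  fixes y :: "'a::field_char_0"
  assumes q: "1 + y \<noteq> 0"
    and eq: "fps_const (1 + y) * D\<^sup>2 - (1 + fps_X) * D + fps_X = 0"
  shows "of_nat (k + 3) * D $ (k + 3) =
    of_nat (2 * k + 3) * (1 + 2 * y) * D $ (k + 2) - of_nat k * D $ (k + 1)"
proof -
  define s where "s = 1 + fps_X - 2 * fps_const (1 + y) * D"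
  define \<Delta> :: "'a fps" where "\<Delta> = 1 - 2 * fps_const (1 + 2 * y) * fps_X + fps_X\<^sup>2"
  have cy: "fps_const (1 + 2 * y) = 2 * fps_const (1 + y) - 1"
    by (rule fps_ext) (simp add: fps_eq_iff numeral_fps_const)
  have sq: "s\<^sup>2 = \<Delta>"
  proof -
    have "s\<^sup>2 - \<Delta> = 4 * fps_const (1 + y) *
        (fps_const (1 + y) * D\<^sup>2 - (1 + fps_X) * D + fps_X)"
      unfolding s_def \<Delta>_def cy by algebra
    then show ?thesis using eq by simp
  qed
  \<comment> \<open>differentiating \<open>s\<^sup>2\<close> and multiplying by \<open>s\<close> removes the square root from the coefficients\<close>
  have "2 * (\<Delta> * fps_deriv s) = s * fps_deriv (s\<^sup>2)"
    unfolding sq[symmetric] by (simp add: fps_deriv_power' power2_eq_square algebra_simps)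
  also have "fps_deriv (s\<^sup>2) = 2 * (fps_X - fps_const (1 + 2 * y))"
    unfolding sq \<Delta>_def by (simp add: fps_deriv_power' power2_eq_square algebra_simps)
  finally have lin: "\<Delta> * fps_deriv s = (fps_X - fps_const (1 + 2 * y)) * s"
    by (simp only: mult.left_commute[of _ 2] mult_cancel_left) (simp add: mult.commute)
  have ode: "fps_deriv s - fps_const (2 * (1 + 2 * y)) * (fps_X * fps_deriv s)
      + fps_X * (fps_X * fps_deriv s) = fps_X * s - fps_const (1 + 2 * y) * s"
  proof -
    have "fps_const (2 * (1 + 2 * y)) = 2 * fps_const (1 + 2 * y)"
      by (simp only: fps_const_mult[symmetric] numeral_fps_const)
    then show ?thesis
      using lin unfolding \<Delta>_def by (simp add: ring_distribs power2_eq_square mult_ac del: fps_const_mult fps_const_add)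
  qed
  have "(fps_deriv s - fps_const (2 * (1 + 2 * y)) * (fps_X * fps_deriv s)
      + fps_X * (fps_X * fps_deriv s)) $ (k + 2) = (fps_X * s - fps_const (1 + 2 * y) * s) $ (k + 2)"
    using ode by simp
  then have rec: "of_nat (k + 3) * s $ (k + 3) =
    of_nat (2 * k + 3) * (1 + 2 * y) * s $ (k + 2) - of_nat k * s $ (k + 1)"
    by (simp add: algebra_simps numeral_3_eq_3 numeral_2_eq_2)
  have sD: "s $ m = - 2 * (1 + y) * D $ m" if "m \<ge> 2" for m
    using that unfolding s_def by (simp add: numeral_fps_const algebra_simps)
  \<comment> \<open>\<open>s\<close> and \<open>D\<close> are proportional from the second coefficient on; for \<open>k = 0\<close> the first one drops out\<close>
  have 1: "of_nat k * s $ (k + 1) = - 2 * (1 + y) * (of_nat k * D $ (k + 1))"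
    by (cases "k = 0") (auto simp: sD)
  have "- 2 * (1 + y) * (of_nat (k + 3) * D $ (k + 3)) = - 2 * (1 + y) *
    (of_nat (2 * k + 3) * (1 + 2 * y) * D $ (k + 2) - of_nat k * D $ (k + 1))"
    using rec unfolding 1 by (simp only: sD algebra_simps) 
  moreover have "- 2 * (1 + y) \<noteq> 0" using q by (simp only: mult_eq_0_iff) simp
  ultimately show ?thesis using mult_left_cancel by blast
qed

text \<open>The ratios \<open>r\<close> of consecutive terms stay in the half-plane of \<open>u\<close>: the map \<open>r \<mapsto> - 1/r\<close> preserves
  each of the two half-planes, so the term \<open>- k / r\<close> in the recurrence can only push the next ratio
  further from the real axis. The leading term \<open>(2 k + 3) / (k + 3) u\<close> has imaginary part at least
  that of \<open>u\<close> in absolute value. This leaves \<open>2 r - u\<close> off the real axis.\<close>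
lemma nonreal_combination_nonzero:
  fixes d :: "nat \<Rightarrow> complex" and u :: complex
  assumes u: "Im u \<noteq> 0" and d2: "d 2 \<noteq> 0"
    and rec: "\<And>k. of_nat (k + 3) * d (k + 3) = of_nat (2 * k + 3) * u * d (k + 2) - of_nat k * d (k + 1)"
  shows "2 * d (n + 3) - u * d (n + 2) \<noteq> 0"
proof -
  have u2: "(Im u)\<^sup>2 > 0" using u by simp
  have inv: "d (k + 2) \<noteq> 0 \<and> Im u * Im (d (k + 3) / d (k + 2)) \<ge> (Im u)\<^sup>2" for k
  proof (induction k)
    case 0
    have "d 3 = u * d 2" using rec[of 0] by (simp add: numeral_2_eq_2)
    then have "d (0 + 3) / d (0 + 2) = u"
      using d2 by (simp add: numeral_2_eq_2)
    then show ?case using d2 by (simp add: power2_eq_square numeral_2_eq_2)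
  next
    case (Suc k)
    define r where "r = d (k + 3) / d (k + 2)"
    have r: "Im u * Im r \<ge> (Im u)\<^sup>2" and nz: "d (k + 2) \<noteq> 0" using Suc by (auto simp: r_def)
    then have "Im r \<noteq> 0" using u2 by auto
    then have r0: "r \<noteq> 0" by auto
    then have nz': "d (k + 3) \<noteq> 0" by (auto simp: r_def)
    define r' where "r' = d (k + 4) / d (k + 3)"
    have "of_nat (k + 4) * d (k + 4) = of_nat (2 * k + 5) * u * d (k + 3) - of_nat (k + 1) * d (k + 2)"
      using rec[of "Suc k"] by (simp add: numeral_eq_Suc)
    then have "of_nat (k + 4) * d (k + 4) / d (k + 3) =
        (of_nat (2 * k + 5) * u * d (k + 3) - of_nat (k + 1) * d (k + 2)) / d (k + 3)" by simp
    then have "of_nat (k + 4) * r' = of_nat (2 * k + 5) * u - of_nat (k + 1) * inverse r"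
      using nz' by (simp add: r'_def r_def diff_divide_distrib)
    then have "Im (of_nat (k + 4) * r') = Im (of_nat (2 * k + 5) * u - of_nat (k + 1) * inverse r)"
      by simp
    moreover have Im_nat: "Im (of_nat j * z) = real j * Im z" for j z by simp
    ultimately have im: "real (k + 4) * Im r' = real (2 * k + 5) * Im u - real (k + 1) * Im (inverse r)"
      by (simp only: minus_complex.sel Im_nat)
    \<comment> \<open>inversion exchanges the half-planes\<close>
    have "Im u * Im (inverse r) = - (Im u * Im r) / (cmod r)\<^sup>2"
      by (simp add: cmod_power2)
    also have "\<dots> \<le> 0" using r u2 by (intro divide_nonpos_nonneg zero_le_power2) linarith
    finally have "Im u * Im (inverse r) \<le> 0" .
    then have "real (k + 1) * (Im u * Im (inverse r)) \<le> 0"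
      by (rule mult_nonneg_nonpos[OF of_nat_0_le_iff])
    then have "real (k + 4) * (Im u * Im r') \<ge> real (2 * k + 5) * (Im u)\<^sup>2"
      using arg_cong[OF im, of "\<lambda>a. Im u * a"] by (simp add: algebra_simps power2_eq_square)
    also have "real (2 * k + 5) * (Im u)\<^sup>2 \<ge> real (k + 4) * (Im u)\<^sup>2"
      by (intro mult_right_mono) auto
    finally (xtrans) have "real (k + 4) * (Im u)\<^sup>2 \<le> real (k + 4) * (Im u * Im r')" .
    then have "(Im u)\<^sup>2 \<le> Im u * Im r'" by (subst (asm) mult_le_cancel_left_pos) auto
    then show ?case using nz' by (simp add: r'_def numeral_eq_Suc)
  qed
  define r where "r = d (n + 3) / d (n + 2)"
  have nz: "d (n + 2) \<noteq> 0" and r: "Im u * Im r \<ge> (Im u)\<^sup>2" using inv[of n] by (auto simp: r_def)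
  have "Im u * Im (2 * r - u) > 0"
    using r u2 by (simp add: algebra_simps power2_eq_square)
  then have "2 * r - u \<noteq> 0" by auto
  moreover have "2 * d (n + 3) - u * d (n + 2) = d (n + 2) * (2 * r - u)"
    using nz by (simp add: r_def algebra_simps)
  ultimately show ?thesis using nz by simp
qed

lemma chain_weight_0 [simp]: "chain_weight y 0 = 1"
  by (simp add: chain_weight_def intervals_def)

lemma chain_weight_1 [simp]: "chain_weight y (Suc 0) = 1"
  by (simp add: chain_weight_def intervals_def)

lemma block_weight_0 [simp]: "block_weight y 0 = 0"
  by (simp add: block_weight_def)

lemma block_weight_1 [simp]: "block_weight y (Suc 0) = 1"
  by (simp add: block_weight_def)

lemma block_weight_2: "block_weight y 2 = y"
proof -
  have "intervals 2 - {{..<2}} = {}"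
    by (auto elim!: intervalsE simp: less_2_cases_iff)
  then show ?thesis unfolding block_weight_def by (simp only: laminar_weight_empty) simp
qed

definition block_fps :: "'a::comm_ring_1 \<Rightarrow> 'a fps" where
  "block_fps y = Abs_fps (block_weight y)"

lemma first_block_convolution:
  fixes f :: "nat \<Rightarrow> 'a::comm_ring_1"
  shows "(block_fps y * Abs_fps f) $ m = (\<Sum>k=1..m. block_weight y k * f (m - k))"
proof -
  have "(block_fps y * Abs_fps f) $ m = (\<Sum>k=0..m. block_weight y k * f (m - k))"
    by (simp add: fps_mult_nth block_fps_def)
  also have "\<dots> = (\<Sum>k=1..m. block_weight y k * f (m - k))"
    by (simp add: sum.atLeast_Suc_atMost)
  finally show ?thesis .
qed

text \<open>Eliminates the generating function \<open>C\<close> of all families on chains from \<open>C = 1 + D C\<close> (cut off the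
  first block) and \<open>D - X = y (C - 1 - D)\<close> (adjoin the whole chain).\<close>
lemma block_fps_quadratic:
  fixes y :: "'a::field_char_0"
  shows "fps_const (1 + y) * (block_fps y)\<^sup>2 - (1 + fps_X) * block_fps y + fps_X = 0"
proof -
  define D where "D = block_fps y"
  define C where "C = Abs_fps (chain_weight y)"
  define c where "c = fps_const y"
  have C: "C = 1 + D * C"
  proof (rule fps_ext)
    fix m show "C $ m = (1 + D * C) $ m"
    proof (cases m)
      case (Suc k)
      have "(D * C) $ Suc k = (\<Sum>j=1..Suc k. block_weight y j * chain_weight y (Suc k - j))"
        unfolding D_def C_def by (rule first_block_convolution)
      then show ?thesis using chain_weight_Suc[of y k] by (simp add: Suc C_def)
    qed (simp add: C_def D_def block_fps_def)
  qed
  have D: "D - fps_X = c * (C - 1 - D)"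
  proof (rule fps_ext)
    fix m :: nat
    consider "m = 0" | "m = 1" | "2 \<le> m" by linarith
    then show "(D - fps_X) $ m = (c * (C - 1 - D)) $ m"
    proof cases
      case 3
      then show ?thesis using block_weight_conv_chain_weight[OF 3, of y]
        by (simp add: D_def block_fps_def C_def c_def)
    qed (simp_all add: D_def block_fps_def C_def c_def)
  qed
  have "(D - fps_X) * (1 - D) = c * (C - 1 - D) * (1 - D)" using D by simp
  also have "\<dots> = c * ((C - D * C) - 1 + D\<^sup>2)"
    by (simp add: algebra_simps power2_eq_square)
  also have "C - D * C = 1" using C by (simp add: algebra_simps)
  finally have "(D - fps_X) * (1 - D) = c * D\<^sup>2" by simp
  moreover have "fps_const (1 + y) = 1 + c" by (simp add: c_def fps_const_add[symmetric] del: fps_const_add)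
  ultimately show ?thesis
    unfolding D_def[symmetric] by (simp add: algebra_simps power2_eq_square)
qed

lemma block_weight_recurrence:
  fixes y :: "'a::field_char_0"
  assumes "1 + y \<noteq> 0"
  shows "of_nat (k + 3) * block_weight y (k + 3) =
    of_nat (2 * k + 3) * (1 + 2 * y) * block_weight y (k + 2) - of_nat k * block_weight y (k + 1)"
  using quadratic_coeff_recurrence[OF assms block_fps_quadratic] by (simp add: block_fps_def)

text \<open>The hypotheses say \<open>X V = X D W + 2 (D - X)\<close> and \<open>W = 1 + (1 + y) V\<close>, so \<open>V\<close> is a quotient with
  denominator \<open>1 - (1 + y) D\<close>. By the quadratic equation of \<open>D\<close> the product of this denominator with
  \<open>(1 + y) D - X\<close> is \<open>y X\<close>, and reducing the numerator modulo the same equation leaves an expression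
  that is linear in \<open>D\<close>.\<close>
lemma first_block_recurrence_solution:
  fixes y :: "'a::field_char_0"
  assumes v: "\<And>m. v (Suc m) = (\<Sum>k=1..Suc m. block_weight y k * w (Suc m - k)) + 2 * block_weight y (m + 2)"
    and w0: "w 0 = 1" and w: "\<And>m. w (Suc m) = (1 + y) * v (Suc m)"
  shows "y * v (Suc m) = 2 * block_weight y (m + 3) - (1 + 2 * y) * block_weight y (m + 2)"
proof -
  define D where "D = block_fps y"
  define V where "V = Abs_fps (\<lambda>m. if m = 0 then 0 else v m)"
  define W where "W = Abs_fps w"
  define c where "c = fps_const y"
  have q: "fps_const (1 + y) = 1 + c" by (simp add: c_def fps_const_add[symmetric] del: fps_const_add)
  have quad: "(1 + c) * D\<^sup>2 - (1 + fps_X) * D + fps_X = 0"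
    using block_fps_quadratic[of y] unfolding q D_def .
  have W: "W = 1 + (1 + c) * V"
    unfolding q[symmetric]
  proof (rule fps_ext)
    fix m show "W $ m = (1 + fps_const (1 + y) * V) $ m"
      by (cases m) (simp_all add: W_def V_def w0 w)
  qed
  have V: "fps_X * V = fps_X * (D * W) + 2 * (D - fps_X)"
  proof (rule fps_ext)
    fix m show "(fps_X * V) $ m = (fps_X * (D * W) + 2 * (D - fps_X)) $ m"
    proof (cases m)
      case (Suc j)
      show ?thesis
      proof (cases j)
        case (Suc i)
        have "(D * W) $ Suc i = (\<Sum>k=1..Suc i. block_weight y k * w (Suc i - k))"
          unfolding D_def W_def by (rule first_block_convolution)
        then have "V $ Suc i = (D * W) $ Suc i + 2 * D $ (i + 2)"
          by (simp add: V_def v D_def block_fps_def)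
        then show ?thesis using \<open>m = Suc j\<close> Suc by (simp add: numeral_fps_const)
      qed (use Suc in \<open>simp add: V_def D_def block_fps_def numeral_fps_const\<close>)
    qed (simp add: D_def block_fps_def numeral_fps_const)
  qed
  have conj: "(1 - (1 + c) * D) * ((1 + c) * D - fps_X) = c * fps_X"
  proof -
    have "(1 - (1 + c) * D) * ((1 + c) * D - fps_X) - c * fps_X =
        - (1 + c) * ((1 + c) * D\<^sup>2 - (1 + fps_X) * D + fps_X)"
      by (simp add: algebra_simps power2_eq_square)
    then show ?thesis unfolding quad by simp
  qed
  have "fps_X * V * (1 - (1 + c) * D) = fps_X * D + 2 * (D - fps_X)"
    using V unfolding W by (simp add: algebra_simps)
  then have "fps_X * V * ((1 - (1 + c) * D) * ((1 + c) * D - fps_X)) =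
      (fps_X * D + 2 * (D - fps_X)) * ((1 + c) * D - fps_X)"
    by (simp only: mult.assoc[symmetric])
  also have "\<dots> = (2 + fps_X) * ((1 + c) * D\<^sup>2 - (1 + fps_X) * D + fps_X)
      + (2 * D - (1 + 2 * c) * (fps_X * D) - 2 * fps_X + fps_X * fps_X)"
    by (simp add: algebra_simps power2_eq_square)
  finally have "fps_X * (fps_X * (c * V)) = 2 * D - (1 + 2 * c) * (fps_X * D) - 2 * fps_X + fps_X * fps_X"
    unfolding conj quad by (simp add: mult_ac)
  moreover have "1 + 2 * c = fps_const (1 + 2 * y)"
    by (simp add: c_def numeral_fps_const fps_const_1_eq_1[symmetric] del: fps_const_1_eq_1)
  ultimately have "(fps_X * (fps_X * (c * V))) $ (m + 3) =
      (2 * D - fps_const (1 + 2 * y) * (fps_X * D) - 2 * fps_X + fps_X * fps_X) $ (m + 3)"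
    by simp
  then show ?thesis
    by (simp add: c_def V_def D_def block_fps_def numeral_fps_const numeral_3_eq_3)
qed

section \<open>A chain below a two-element antichain\<close>

lemma Plus_subset_iff: "A <+> B \<subseteq> C <+> D \<longleftrightarrow> A \<subseteq> C \<and> B \<subseteq> D"
  by (auto simp: Plus_def)

lemma Plus_eq_iff: "A <+> B = C <+> D \<longleftrightarrow> A = C \<and> B = D"
  unfolding set_eq_subset Plus_subset_iff by blast

lemma Plus_Int_Plus: "(A <+> B) \<inter> (C <+> D) = (A \<inter> C) <+> (B \<inter> D)"
  by (auto simp: Plus_def)

lemma Plus_empty: "{} <+> {} = {}"
  by (simp add: Plus_def)

lemma map_sum_image_Plus: "map_sum f id ` (A <+> B) = f ` A <+> B"
  by (force simp: Plus_def image_Un image_image)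

text \<open>For \<open>m > 0\<close> these are the proper tubes of the poset with a chain of \<open>m\<close> elements below the antichain
  \<open>{0, 1}\<close>, together with the whole poset. The antichain alone is not connected, so a proper tube
  that meets it also contains an element of the chain, and then everything above this element in
  the chain. For \<open>m = 0\<close> there are none.\<close>
definition tubes :: "nat \<Rightarrow> (nat + nat) set set" where
  "tubes m = {{a..b} <+> {} | a b. a < b \<and> b < m} \<union>
     {{a..<m} <+> J | a J. a < m \<and> J \<in> {{0}, {1}, {0, 1}}}"

definition whole :: "nat \<Rightarrow> (nat + nat) set" where
  "whole m = {0..<m} <+> {0, 1}"

lemma tubes_intervalI: "a < b \<Longrightarrow> b < m \<Longrightarrow> {a..b} <+> {} \<in> tubes m"
  unfolding tubes_def by blast

lemma tubes_topI: "a < m \<Longrightarrow> J \<in> {{0}, {1}, {0, 1}} \<Longrightarrow> {a..<m} <+> J \<in> tubes m"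
  unfolding tubes_def by blast

lemma tubesE:
  assumes "B \<in> tubes m"
  obtains (interval) a b where "B = {a..b} <+> {}" "a < b" "b < m"
  | (top) a J where "B = {a..<m} <+> J" "a < m" "J \<in> {{0}, {1}, {0, 1}}"
  using assms unfolding tubes_def by blast

lemma tubes_0 [simp]: "tubes 0 = {}"
  by (auto elim!: tubesE)

lemma tubes_subset_whole: "B \<in> tubes m \<Longrightarrow> B \<subseteq> whole m"
  by (erule tubesE) (auto simp: whole_def)

lemma empty_notin_tubes: "{} \<notin> tubes m"
  by (auto elim!: tubesE simp: Plus_def)

lemma finite_tubes: "finite (tubes m)"
proof (rule finite_subset)
  show "tubes m \<subseteq> Pow (whole m)" using tubes_subset_whole by blast
  show "finite (Pow (whole m))" by (simp add: whole_def)
qed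

text \<open>The whole poset is left out because it is not a proper tube; on the smaller posets that arise by
  removing an initial segment of the chain it is allowed, which explains the difference between
  this weight and that of all the \<open>tubes\<close>.\<close>
definition tubing_weight :: "'a::comm_ring_1 \<Rightarrow> nat \<Rightarrow> 'a" where
  "tubing_weight y m = laminar_weight y (tubes m - {whole m})"

lemma laminar_weight_tubes_Suc:
  "laminar_weight y (tubes (Suc m)) = (1 + y) * tubing_weight y (Suc m)"
  unfolding tubing_weight_def
proof (rule laminar_weight_greatest)
  show "whole (Suc m) \<in> tubes (Suc m)" unfolding whole_def by (rule tubes_topI) auto
qed (use finite_tubes tubes_subset_whole in auto)

text \<open>What remains above the first \<open>k\<close> elements of the chain is a poset of the same kind. Its greatest
  tube, once shifted, is a proper tube of the larger poset.\<close>
lemma tubes_apart: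
  assumes "1 \<le> k" "k \<le> m"
  shows "{B \<in> tubes m - {whole m}. B \<inter> ({..<k} <+> {}) = {}} =
    (`) (map_sum (\<lambda>i. i + k) id) ` tubes (m - k)"
proof (intro equalityI subsetI)
  fix B assume "B \<in> {B \<in> tubes m - {whole m}. B \<inter> ({..<k} <+> {}) = {}}"
  then have B: "B \<in> tubes m" and dis: "B \<inter> ({..<k} <+> {}) = {}" by auto
  from B show "B \<in> (`) (map_sum (\<lambda>i. i + k) id) ` tubes (m - k)"
  proof (cases rule: tubesE)
    case (interval a b)
    have "Inl a \<in> B" using interval by auto
    then have "k \<le> a" using dis by (metis InlI disjoint_iff lessThan_iff not_le)
    then have "B = map_sum (\<lambda>i. i + k) id ` ({a - k..b - k} <+> {})"
      using interval unfolding map_sum_image_Plus image_add_atLeastAtMost' by simp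
    moreover have "{a - k..b - k} <+> {} \<in> tubes (m - k)"
      by (rule tubes_intervalI) (use interval \<open>k \<le> a\<close> in auto)
    ultimately show ?thesis by blast
  next
    case (top a J)
    have "Inl a \<in> B" using top by auto
    then have "k \<le> a" using dis by (metis InlI disjoint_iff lessThan_iff not_le)
    then have "B = map_sum (\<lambda>i. i + k) id ` ({a - k..<m - k} <+> J)"
      using top unfolding map_sum_image_Plus image_add_atLeastLessThan' by auto
    moreover have "{a - k..<m - k} <+> J \<in> tubes (m - k)"
      using top \<open>k \<le> a\<close> by (intro tubes_topI) auto
    ultimately show ?thesis by blast
  qed
next
  fix B assume "B \<in> (`) (map_sum (\<lambda>i. i + k) id) ` tubes (m - k)"
  then obtain B' where B: "B = map_sum (\<lambda>i. i + k) id ` B'" and B': "B' \<in> tubes (m - k)" by blast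
  from B' show "B \<in> {B \<in> tubes m - {whole m}. B \<inter> ({..<k} <+> {}) = {}}"
  proof (cases rule: tubesE)
    case (interval a b)
    then have eq: "B = {a + k..b + k} <+> {}" unfolding B by (simp only: map_sum_image_Plus image_add_atLeastAtMost')
    have "B \<in> tubes m" unfolding eq by (rule tubes_intervalI) (use interval in auto)
    moreover have "B \<noteq> whole m" by (simp add: eq whole_def Plus_eq_iff)
    moreover have "{a + k..b + k} \<inter> {..<k} = {}" by auto
    then have "B \<inter> ({..<k} <+> {}) = {}" by (simp add: eq Plus_Int_Plus Plus_empty)
    ultimately show ?thesis by simp
  next
    case (top a J)
    then have eq: "B = {a + k..<m} <+> J"
      using assms unfolding B by (simp add: map_sum_image_Plus image_add_atLeastLessThan')
    have "B \<in> tubes m" unfolding eq by (rule tubes_topI) (use top in auto)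
    moreover have "0 \<in> {0..<m} - {a + k..<m}" using assms by simp
    then have "{a + k..<m} \<noteq> {0..<m}" by blast
    then have "B \<noteq> whole m" by (simp add: eq whole_def Plus_eq_iff)
    moreover have "{a + k..<m} \<inter> {..<k} = {}" by auto
    then have "B \<inter> ({..<k} <+> {}) = {}" by (simp add: eq Plus_Int_Plus Plus_empty)
    ultimately show ?thesis by simp
  qed
qed

lemma laminar_weight_tubes_apart:
  assumes "1 \<le> k" "k \<le> m"
  shows "laminar_weight y {B \<in> tubes m - {whole m}. B \<inter> ({..<k} <+> {}) = {}} =
    laminar_weight y (tubes (m - k))"
  unfolding tubes_apart[OF assms]
proof (rule laminar_weight_transport)
  show "inj_on (map_sum (\<lambda>i. i + k) id) (UNIV :: (nat + nat) set)"
    by (intro sum.inj_map) (auto simp: inj_on_def)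
qed simp

lemma laminar_weight_below_interval:
  assumes "1 \<le> b" "b < m"
  shows "y * laminar_weight y {B \<in> tubes m - {whole m}. B \<subset> {0..b} <+> {}} = block_weight y (Suc b)"
proof -
  have "{B \<in> tubes m - {whole m}. B \<subset> {0..b} <+> {}} =
      {Inl ` {a'..b'} | a' b'. a' < b' \<and> b' < Suc b} - {Inl ` {..<Suc b}}"
    (is "?L = ?R")
  proof (intro equalityI subsetI)
    fix B assume "B \<in> ?L"
    then have B: "B \<in> tubes m" and sub: "B \<subset> {0..b} <+> {}" by auto
    from B show "B \<in> ?R"
    proof (cases rule: tubesE)
      case (interval a' b')
      have "Inl b' \<in> B" using interval by auto
      then have "Inl b' \<in> {0..b} <+> {}" using sub by blast
      then have "b' < Suc b" by auto
      moreover have "B = Inl ` {a'..b'}" using interval by (simp add: Plus_def)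
      moreover have "Inl ` {..<Suc b} = {0..b} <+> {}" by (simp add: Plus_def lessThan_Suc_atMost atLeast0AtMost)
      ultimately show ?thesis using interval sub by blast
    next
      case (top a' J)
      then obtain l where "l \<in> J" by auto
      then have "Inr l \<in> B" using top by auto
      then show ?thesis using sub by auto
    qed
  next
    fix B assume "B \<in> ?R"
    then obtain a' b' where B: "B = {a'..b'} <+> {}" "a' < b'" "b' < Suc b" and ne: "B \<noteq> Inl ` {..<Suc b}"
      unfolding Plus_def by (simp del: atLeastAtMost_iff) blast
    have "Inl ` {..<Suc b} = {0..b} <+> {}" by (simp add: Plus_def lessThan_Suc_atMost atLeast0AtMost)
    then have "B \<subset> {0..b} <+> {}" using ne B by auto
    moreover have "B \<in> tubes m" unfolding B(1) by (rule tubes_intervalI) (use B assms in auto)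
    moreover have "B \<noteq> whole m" using B by (simp add: whole_def Plus_eq_iff)
    ultimately show "B \<in> ?L" by simp
  qed
  moreover have "y * laminar_weight y ?R = block_weight y (Suc b)"
    by (rule block_weight_transport) (use assms in auto)
  ultimately show ?thesis by simp
qed

text \<open>A tube with a single element \<open>l\<close> of the antichain is a chain with one more element, so the
  tubes inside it are counted like intervals. The map \<open>g\<close> enumerates this chain.\<close>
lemma laminar_weight_below_top:
  assumes l: "l \<in> {0, 1}"
  shows "y * laminar_weight y {B \<in> tubes (Suc m) - {whole (Suc m)}. B \<subset> {0..<Suc m} <+> {l}} =
    block_weight y (m + 2)"
proof -
  define g where "g i = (if i < Suc m then Inl i else Inr l)" for i :: nat
  have img: "g ` {a..b} = {a..b} <+> {}" if "b < Suc m" for a b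
    using that by (force simp: g_def Plus_def)
  have img_top: "g ` {a..Suc m} = {a..<Suc m} <+> {l}" if "a < Suc m" for a
  proof -
    have "{a..Suc m} = insert (Suc m) {a..<Suc m}" using that by auto
    then show ?thesis by (force simp: g_def Plus_def)
  qed
  have img_all: "g ` {..<m + 2} = {0..<Suc m} <+> {l}"
  proof -
    have "{..<m + 2} = {0..Suc m}" by auto
    then show ?thesis using img_top[of 0] by simp
  qed
  have "{B \<in> tubes (Suc m) - {whole (Suc m)}. B \<subset> {0..<Suc m} <+> {l}} =
      {g ` {a..b} | a b. a < b \<and> b < m + 2} - {g ` {..<m + 2}}"
    (is "?L = ?R")
  proof (intro equalityI subsetI)
    fix B assume "B \<in> ?L"
    then have B: "B \<in> tubes (Suc m)" and sub: "B \<subset> {0..<Suc m} <+> {l}" by auto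
    from B have "\<exists>a b. B = g ` {a..b} \<and> a < b \<and> b < m + 2"
    proof (cases rule: tubesE)
      case (interval a b)
      then have "B = g ` {a..b}" using img[of b a] by simp
      moreover have "b < m + 2" using interval by simp
      ultimately show ?thesis using interval by blast
    next
      case (top a J)
      have "J \<subseteq> {l}" using sub top by (simp add: psubset_eq Plus_subset_iff)
      then have "J = {l}" using top by auto
      then have "B = g ` {a..Suc m}" using top img_top[of a] by simp
      moreover have "a < Suc m" "Suc m < m + 2" using top by auto
      ultimately show ?thesis by blast
    qed
    then show "B \<in> ?R" using sub img_all by blast
  next
    fix B assume "B \<in> ?R"
    then obtain a b where B: "B = g ` {a..b}" "a < b" "b < m + 2" and ne: "B \<noteq> g ` {..<m + 2}" by blast
    have "B \<in> tubes (Suc m)"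
    proof (cases "b < Suc m")
      case True
      then have eq: "B = {a..b} <+> {}" using B img by simp
      show ?thesis unfolding eq by (rule tubes_intervalI) (use B True in auto)
    next
      case False
      then have "b = Suc m" using B by simp
      then have eq: "B = {a..<Suc m} <+> {l}" using B img_top[of a] by simp
      show ?thesis unfolding eq by (rule tubes_topI) (use B l in auto)
    qed
    moreover have "B \<subset> {0..<Suc m} <+> {l}"
    proof -
      have "B \<subseteq> g ` {..<m + 2}" unfolding B(1) using B(3) by (intro image_mono) auto
      then show ?thesis using ne unfolding img_all by blast
    qed
    moreover have "B \<noteq> whole (Suc m)"
    proof
      assume "B = whole (Suc m)"
      then have "{0, 1} \<subseteq> {l}" using \<open>B \<subset> {0..<Suc m} <+> {l}\<close>
        by (simp add: psubset_eq Plus_subset_iff whole_def)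
      then show False by auto
    qed
    ultimately show "B \<in> ?L" by simp
  qed
  moreover have "y * laminar_weight y ?R = block_weight y (m + 2)"
    by (rule block_weight_transport) (auto simp: inj_on_def g_def split: if_splits)
  ultimately show ?thesis by simp
qed

text \<open>The largest tube through the bottom element is an initial segment of the chain, or the whole
  chain with one of the two top elements; the latter meets every other tube, which gives the
  extra term. The bottom element in no tube accounts for \<open>k = 1\<close>.\<close>
lemma tubing_weight_Suc:
  "tubing_weight y (Suc m) =
    (\<Sum>k=1..Suc m. block_weight y k * laminar_weight y (tubes (Suc m - k))) + 2 * block_weight y (m + 2)"
proof -
  let ?U = "tubes (Suc m) - {whole (Suc m)}"
  let ?F = "\<lambda>A. y * laminar_weight y {B\<in>?U. B \<subset> A} * laminar_weight y {B\<in>?U. B \<inter> A = {}}"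
  let ?I = "\<lambda>b. {0..b} <+> {} :: (nat + nat) set"
  let ?T = "\<lambda>l. {0..<Suc m} <+> {l} :: (nat + nat) set"
  have without: "laminar_weight y {B\<in>?U. Inl 0 \<notin> B} = laminar_weight y (tubes m)"
  proof -
    have "{B\<in>?U. Inl 0 \<notin> B} = {B\<in>?U. B \<inter> ({..<1} <+> {}) = {}}"
      by (auto simp: Plus_def)
    then show ?thesis using laminar_weight_tubes_apart[of 1 "Suc m" y] by simp
  qed
  have containing: "{A. A \<in> ?U \<and> Inl 0 \<in> A} = ?I ` {1..m} \<union> {?T 0, ?T 1}"
  proof (intro equalityI subsetI)
    fix A assume "A \<in> {A. A \<in> ?U \<and> Inl 0 \<in> A}"
    then have A: "A \<in> tubes (Suc m)" and ne: "A \<noteq> whole (Suc m)" and 0: "Inl 0 \<in> A" by auto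
    from A show "A \<in> ?I ` {1..m} \<union> {?T 0, ?T 1}"
    proof (cases rule: tubesE)
      case (interval a b)
      then show ?thesis using 0 by auto
    next
      case (top a J)
      then have "a = 0" using 0 by auto
      then show ?thesis using top ne by (auto simp: whole_def)
    qed
  next
    fix A assume A: "A \<in> ?I ` {1..m} \<union> {?T 0, ?T 1}"
    have "?I b \<in> tubes (Suc m)" if "b \<in> {1..m}" for b
      by (rule tubes_intervalI) (use that in auto)
    moreover have "?T l \<in> tubes (Suc m)" if "l \<in> {0, 1}" for l
      by (rule tubes_topI) (use that in auto)
    ultimately have "A \<in> tubes (Suc m)" using A by blast
    moreover have "A \<noteq> whole (Suc m)"
    proof -
      have "Inr 0 \<in> whole (Suc m)" "Inr 1 \<in> whole (Suc m)" by (auto simp: whole_def)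
      moreover have "Inr 0 \<notin> A \<or> Inr 1 \<notin> A" using A by auto
      ultimately show ?thesis by blast
    qed
    moreover have "Inl 0 \<in> A" using A by auto
    ultimately show "A \<in> {A. A \<in> ?U \<and> Inl 0 \<in> A}" by simp
  qed
  have intervals: "?F (?I b) = block_weight y (Suc b) * laminar_weight y (tubes (Suc m - Suc b))"
    if "b \<in> {1..m}" for b
  proof -
    have "?I b = {..<Suc b} <+> {}" by (simp add: lessThan_Suc_atMost atLeast0AtMost)
    then have "laminar_weight y {B\<in>?U. B \<inter> ?I b = {}} = laminar_weight y (tubes (Suc m - Suc b))"
      using laminar_weight_tubes_apart[of "Suc b" "Suc m" y] that by simp
    then show ?thesis using laminar_weight_below_interval[of b "Suc m" y] that by simp
  qed
  have tops: "?F (?T l) = block_weight y (m + 2)" if "l \<in> {0, 1}" for l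
  proof -
    have "B \<inter> ?T l \<noteq> {}" if "B \<in> ?U" for B
    proof -
      from that have "B \<in> tubes (Suc m)" by simp
      then show ?thesis
      proof (cases rule: tubesE)
        case (interval a b)
        then have "Inl a \<in> B \<inter> ?T l" by auto
        then show ?thesis by blast
      next
        case (top a J)
        then have "Inl a \<in> B \<inter> ?T l" by auto
        then show ?thesis by blast
      qed
    qed
    then have apart: "{B\<in>?U. B \<inter> ?T l = {}} = {}" by blast
    show ?thesis unfolding apart using laminar_weight_below_top[OF that, of y m] by simp
  qed
  have "tubing_weight y (Suc m) = laminar_weight y (tubes m) + (\<Sum>A\<in>?I ` {1..m} \<union> {?T 0, ?T 1}. ?F A)"
    unfolding tubing_weight_def without[symmetric] containing[symmetric]
    by (rule laminar_weight_split) (simp_all add: finite_tubes empty_notin_tubes)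
  also have "(\<Sum>A\<in>?I ` {1..m} \<union> {?T 0, ?T 1}. ?F A) = (\<Sum>A\<in>?I ` {1..m}. ?F A) + (\<Sum>A\<in>{?T 0, ?T 1}. ?F A)"
  proof (rule sum.union_disjoint)
    have "?I b \<noteq> ?T l" for b l by (simp only: Plus_eq_iff) simp
    then show "?I ` {1..m} \<inter> {?T 0, ?T 1} = {}" by blast
  qed simp_all
  also have "(\<Sum>A\<in>?I ` {1..m}. ?F A) = (\<Sum>b=1..m. ?F (?I b))"
    by (subst sum.reindex) (auto simp: inj_on_def Plus_eq_iff)
  also have "\<dots> = (\<Sum>b=1..m. block_weight y (Suc b) * laminar_weight y (tubes (Suc m - Suc b)))"
    by (rule sum.cong[OF refl intervals])
  also have "(\<Sum>A\<in>{?T 0, ?T 1}. ?F A) = ?F (?T 0) + ?F (?T 1)"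
    by (subst sum.insert) (auto simp: Plus_eq_iff)
  also have "\<dots> = 2 * block_weight y (m + 2)"
    unfolding tops[OF insertI1] tops[OF insertI2[OF singletonI]] by simp
  finally show ?thesis unfolding sum_first_block by simp
qed

lemma tubing_weight_closed_form:
  fixes y :: "'a::field_char_0"
  shows "y * tubing_weight y (Suc m) = 2 * block_weight y (m + 3) - (1 + 2 * y) * block_weight y (m + 2)"
  by (rule first_block_recurrence_solution[where w = "\<lambda>m. laminar_weight y (tubes m)"])
     (simp_all only: tubing_weight_Suc laminar_weight_tubes_Suc tubes_0 laminar_weight_empty)

text \<open>That \<open>y\<close> is nonreal serves three times: \<open>u = 1 + 2 y\<close> is nonreal, the initial value \<open>D\<^sub>2 = y\<close> of
  the recurrence is nonzero, and so is the leading coefficient \<open>1 + y\<close> of the quadratic equation.\<close>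
lemma tubing_weight_nonzero:
  fixes y :: complex
  assumes "y \<notin> \<real>"
  shows "tubing_weight y (Suc m) \<noteq> 0"
proof -
  have im: "Im y \<noteq> 0" using assms by (simp add: complex_is_Real_iff)
  have "y \<noteq> 0" "1 + y \<noteq> 0" using im by (auto simp: complex_eq_iff)
  then have "2 * block_weight y (m + 3) - (1 + 2 * y) * block_weight y (m + 2) \<noteq> 0"
    using im block_weight_recurrence[of y]
    by (intro nonreal_combination_nonzero) (simp_all add: block_weight_2)
  then show ?thesis unfolding tubing_weight_closed_form[symmetric] by simp
qed

section \<open>Tubings of the poset as laminar families\<close>

lemma hasse_edges_A_poset:
  assumes "(x, y) \<in> hasse_edges (A_poset n k)"
  shows "isl x \<or> isl y"
  using assms unfolding hasse_edges_def covers_def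
  by (cases x; cases y) (auto simp: A_poset_iff)

lemma covers_A_poset:
  "i < n \<Longrightarrow> covers (A_poset n k) (Inl i) (Inl (Suc i))"
  "l < k \<Longrightarrow> covers (A_poset n k) (Inl n) (Inr l)"
proof -
  have 1: "\<not> (z \<noteq> Inl i \<and> z \<noteq> Inl (Suc i) \<and> (Inl i, z) \<in> A_poset n k \<and> (z, Inl (Suc i)) \<in> A_poset n k)" for z
    by (cases z) (auto simp: A_poset_iff)
  have 2: "\<not> (z \<noteq> Inl n \<and> z \<noteq> Inr l \<and> (Inl n, z) \<in> A_poset n k \<and> (z, Inr l) \<in> A_poset n k)" for z
    by (cases z) (auto simp: A_poset_iff)
  show "i < n \<Longrightarrow> covers (A_poset n k) (Inl i) (Inl (Suc i))"
    using 1 unfolding covers_def by (simp add: A_poset_iff)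
  show "l < k \<Longrightarrow> covers (A_poset n k) (Inl n) (Inr l)"
    using 2 unfolding covers_def by (simp add: A_poset_iff)
qed

text \<open>Such a set is connected because each of its elements is reached from \<open>Inl a\<close> by going up
  the chain; the top of the chain is the only neighbour of the antichain elements.\<close>
lemma tube_Plus:
  assumes ab: "a \<le> b" "b \<le> n" and J: "J \<subseteq> {..<k}" and top: "J \<noteq> {} \<Longrightarrow> b = n"
  shows "tube (A_poset n k) ({a..b} <+> J)"
proof -
  let ?\<tau> = "{a..b} <+> J"
  let ?E = "hasse_edges (A_poset n k) \<inter> ?\<tau> \<times> ?\<tau>"
  have chain: "(Inl a, Inl i) \<in> ?E\<^sup>*" if "a \<le> i" "i \<le> b" for i
    using that
  proof (induction i rule: dec_induct)
    case (step i)
    then have "(Inl i, Inl (Suc i)) \<in> ?E"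
      using covers_A_poset(1)[of i n k] ab by (auto simp: hasse_edges_def)
    moreover have "(Inl a, Inl i) \<in> ?E\<^sup>*" using step by simp
    ultimately show ?case by (rule rtrancl_into_rtrancl[rotated])
  qed simp
  have reach: "(Inl a, x) \<in> ?E\<^sup>*" if "x \<in> ?\<tau>" for x
  proof (cases x)
    case (Inl i)
    then show ?thesis using that chain by auto
  next
    case (Inr l)
    then have "l \<in> J" using that by auto
    then have "b = n" "l < k" using J top by auto
    then have "(Inl n, x) \<in> ?E"
      using covers_A_poset(2)[of l k n] ab \<open>l \<in> J\<close> Inr by (auto simp: hasse_edges_def)
    moreover have "(Inl a, Inl n) \<in> ?E\<^sup>*" using chain[of n] ab \<open>b = n\<close> by simp
    ultimately show ?thesis by (rule rtrancl_into_rtrancl[rotated])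
  qed
  have "sym ?E" by (auto simp: sym_def hasse_edges_def)
  note sym = sym_rtrancl[OF this]
  have coreach: "(x, Inl a) \<in> ?E\<^sup>*" if "x \<in> ?\<tau>" for x
    by (rule symD[OF sym reach[OF that]])
  have "hasse_connected (A_poset n k) ?\<tau>"
    unfolding hasse_connected_def
  proof (intro ballI)
    fix x y assume x: "x \<in> ?\<tau>" and y: "y \<in> ?\<tau>"
    show "(x, y) \<in> ?E\<^sup>*" by (rule rtrancl_trans[OF coreach[OF x] reach[OF y]])
  qed
  moreover have "order_convex (A_poset n k) ?\<tau>"
    unfolding order_convex_def
  proof (intro ballI impI)
    fix x z y assume xz: "x \<in> ?\<tau>" "z \<in> ?\<tau>" and le: "(x, y) \<in> A_poset n k" "(y, z) \<in> A_poset n k"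
    have "n \<le> b" if "Inr l \<in> ?\<tau>" for l using that top by auto
    then show "y \<in> ?\<tau>" using xz le
      by (cases x; cases y; cases z) (fastforce simp: A_poset_iff)+
  qed
  moreover have "?\<tau> \<subseteq> Field (A_poset n k)"
    using ab J by (auto simp: Field_A_poset)
  ultimately show ?thesis by (simp add: tube_def)
qed

text \<open>Convexity alone determines the shape as soon as the chain is met: the part in the chain is an
  interval, and it reaches the top of the chain if an element above the chain is present.
  Connectedness excludes several elements of the antichain on their own, as no edge joins them.\<close>
lemma tube_A_poset_cases:
  assumes tube: "tube (A_poset n k) \<tau>" and card: "1 < card \<tau>"
  obtains a b J where "\<tau> = {a..b} <+> J" "a \<le> b" "b \<le> n" "J \<subseteq> {..<k}"
    "J = {} \<Longrightarrow> a < b" "J \<noteq> {} \<Longrightarrow> b = n"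
proof -
  have sub: "\<tau> \<subseteq> Field (A_poset n k)" and conn: "hasse_connected (A_poset n k) \<tau>"
    and conv: "order_convex (A_poset n k) \<tau>" using tube by (auto simp: tube_def)
  define I where "I = {i. Inl i \<in> \<tau>}"
  define J where "J = {l. Inr l \<in> \<tau>}"
  have \<tau>: "\<tau> = I <+> J"
  proof (rule set_eqI)
    fix x show "x \<in> \<tau> \<longleftrightarrow> x \<in> I <+> J" by (cases x) (auto simp: I_def J_def)
  qed
  have I: "I \<subseteq> {..n}" and J: "J \<subseteq> {..<k}"
    using sub by (auto simp: I_def J_def Field_A_poset)
  have finI: "finite I" using I by (rule finite_subset) simp
  have "I \<noteq> {}"
  proof
    assume "I = {}"
    then have "hasse_edges (A_poset n k) \<inter> \<tau> \<times> \<tau> = {}"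
      using hasse_edges_A_poset[of _ _ n k] by (fastforce simp: \<tau> isl_def)
    then have "x = y" if "x \<in> \<tau>" "y \<in> \<tau>" for x y
      using conn that unfolding hasse_connected_def by simp
    moreover have "finite \<tau>" using card by (intro card_ge_0_finite) simp
    ultimately have "card \<tau> \<le> Suc 0" by (simp add: card_le_Suc0_iff_eq)
    then show False using card by simp
  qed
  define a b where "a = Min I" and "b = Max I"
  have ab: "a \<in> I" "b \<in> I" "a \<le> b" "b \<le> n"
    using finI \<open>I \<noteq> {}\<close> I by (auto simp: a_def b_def)
  have "I = {a..b}"
  proof (intro equalityI subsetI)
    fix i assume "i \<in> {a..b}"
    moreover then have "Inl i \<in> Field (A_poset n k)" using ab by (auto simp: Field_A_poset)
    ultimately have "Inl i \<in> \<tau>"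
      using conv[unfolded order_convex_def, rule_format, of "Inl a" "Inl b" "Inl i"] ab
      by (auto simp: I_def A_poset_iff)
    then show "i \<in> I" by (simp add: I_def)
  qed (use finI in \<open>auto simp: a_def b_def\<close>)
  moreover have "b = n" if "J \<noteq> {}"
  proof -
    from that obtain l where l: "l \<in> J" by auto
    have "Inl n \<in> Field (A_poset n k)" by (auto simp: Field_A_poset)
    then have "Inl n \<in> \<tau>"
      using conv[unfolded order_convex_def, rule_format, of "Inl a" "Inr l" "Inl n"] ab l J
      by (auto simp: I_def J_def A_poset_iff)
    then have "n \<in> I" by (simp add: I_def)
    then show ?thesis using finI ab by (auto simp: b_def intro: antisym)
  qed
  moreover have "a < b" if "J = {}"
  proof (rule ccontr)
    assume "\<not> a < b"
    then have "\<tau> = {Inl a}" using ab that \<open>I = {a..b}\<close> unfolding \<tau> by (auto simp: Plus_def)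
    then show False using card by simp
  qed
  ultimately show ?thesis using that[of a b J] \<tau> ab J by blast
qed

lemma subsets_of_two: "J \<subseteq> {..<2} \<Longrightarrow> J \<noteq> {} \<Longrightarrow> J \<in> {{0}, {1}, {0, 1::nat}}"
proof -
  assume "J \<subseteq> {..<2}" "J \<noteq> {}"
  moreover have "{..<2} = {0, 1::nat}" by auto
  ultimately have "J \<in> Pow {0, 1}" by simp
  then show ?thesis using \<open>J \<noteq> {}\<close> by (simp add: Pow_insert Pow_empty) blast
qed

lemma Field_A_poset_2: "Field (A_poset n 2) = whole (Suc n)"
proof -
  have "{..<2} = {0, 1::nat}" by auto
  then show ?thesis by (simp add: Field_A_poset whole_def atLeast0LessThan)
qed

lemma proper_tube_iff: "proper_tube (A_poset n 2) \<tau> \<longleftrightarrow> \<tau> \<in> tubes (Suc n) - {whole (Suc n)}"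
proof
  assume proper: "proper_tube (A_poset n 2) \<tau>"
  then obtain a b J where \<tau>: "\<tau> = {a..b} <+> J" "a \<le> b" "b \<le> n" "J \<subseteq> {..<2}"
    "J = {} \<Longrightarrow> a < b" "J \<noteq> {} \<Longrightarrow> b = n"
    unfolding proper_tube_def by (meson tube_A_poset_cases)
  have "\<tau> \<in> tubes (Suc n)"
  proof (cases "J = {}")
    case True
    then have "\<tau> = {a..b} <+> {}" using \<tau> by simp
    then show ?thesis using tubes_intervalI[of a b "Suc n"] \<tau>(3) \<tau>(5)[OF True] by simp
  next
    case False
    then have "b = n" using \<tau> by simp
    then have "\<tau> = {a..<Suc n} <+> J" using \<tau> by (simp add: atLeastLessThanSuc_atLeastAtMost)
    then show ?thesis using tubes_topI[OF _ subsets_of_two[OF \<tau>(4) False], of a "Suc n"] \<tau> by simp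
  qed
  moreover have "\<tau> \<noteq> whole (Suc n)" using proper by (auto simp: proper_tube_def Field_A_poset_2)
  ultimately show "\<tau> \<in> tubes (Suc n) - {whole (Suc n)}" by simp
next
  assume \<tau>: "\<tau> \<in> tubes (Suc n) - {whole (Suc n)}"
  then have mem: "\<tau> \<in> tubes (Suc n)" by simp
  have finite: "finite (whole (Suc n))" by (simp add: whole_def)
  have "\<tau> \<subset> whole (Suc n)" using \<tau> tubes_subset_whole by blast
  then have "card \<tau> < card (Field (A_poset n 2))"
    unfolding Field_A_poset_2 using finite by (intro psubset_card_mono)
  moreover have "tube (A_poset n 2) \<tau> \<and> 1 < card \<tau>"
    using mem
  proof (cases rule: tubesE)
    case (interval a b)
    then show ?thesis using tube_Plus[of a b n "{}" 2] by (simp add: card_Plus)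
  next
    case (top a J)
    have J: "finite J" "J \<noteq> {}" "J \<subseteq> {..<2}" using top by auto
    then have "0 < card J" by (simp add: card_gt_0_iff)
    then have "1 < card \<tau>" using top J by (simp add: card_Plus)
    moreover have "\<tau> = {a..n} <+> J" using top by (simp add: atLeastLessThanSuc_atLeastAtMost)
    ultimately show ?thesis using tube_Plus[of a n n J 2] top J by simp
  qed
  ultimately show "proper_tube (A_poset n 2) \<tau>" by (simp add: proper_tube_def)
qed

text \<open>The condition on cycles holds automatically, because the least chain element \<open>\<mu>\<close> increases along
  \<open>\<prec>\<close>: if \<open>x \<preceq> y\<close> with \<open>x \<in> \<sigma>\<close>, \<open>y \<in> \<tau>\<close> and \<open>\<mu> \<tau> \<le> \<mu> \<sigma>\<close>, then \<open>x\<close> lies between \<open>\<mu> \<tau>\<close> and \<open>y\<close>, and by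
  convexity \<open>\<sigma>\<close> and \<open>\<tau>\<close> meet in \<open>x\<close>.\<close>
lemma acyclic_tube_prec:
  assumes T: "\<And>\<tau>. \<tau> \<in> T \<Longrightarrow> proper_tube (A_poset n k) \<tau>"
  shows "acyclic {(\<sigma>, \<tau>). \<sigma> \<in> T \<and> \<tau> \<in> T \<and> tube_prec (A_poset n k) \<sigma> \<tau>}"
proof -
  define \<mu> where "\<mu> \<tau> = (LEAST i. Inl i \<in> \<tau>)" for \<tau> :: "(nat + nat) set"
  have \<mu>: "Inl (\<mu> \<tau>) \<in> \<tau>" if \<tau>: "\<tau> \<in> T" for \<tau>
  proof -
    obtain a b J where "\<tau> = {a..b} <+> J" "a \<le> b"
      using T[OF \<tau>] unfolding proper_tube_def by (meson tube_A_poset_cases)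
    then have "Inl a \<in> \<tau>" by auto
    then show ?thesis unfolding \<mu>_def by (rule LeastI)
  qed
  have less: "\<mu> \<sigma> < \<mu> \<tau>" if "\<sigma> \<in> T" "\<tau> \<in> T" "tube_prec (A_poset n k) \<sigma> \<tau>" for \<sigma> \<tau>
  proof (rule ccontr)
    assume "\<not> \<mu> \<sigma> < \<mu> \<tau>"
    from that(3) obtain x y where dis: "\<sigma> \<inter> \<tau> = {}" and xy: "x \<in> \<sigma>" "y \<in> \<tau>" "(x, y) \<in> A_poset n k"
      unfolding tube_prec_def by blast
    have "x \<noteq> y" using dis xy by auto
    then obtain i where x: "x = Inl i" using xy(3) by (cases x; cases y) (auto simp: A_poset_iff)
    have "\<mu> \<sigma> \<le> i" unfolding \<mu>_def using xy x by (intro Least_le) simp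
    then have le: "\<mu> \<tau> \<le> i" using \<open>\<not> \<mu> \<sigma> < \<mu> \<tau>\<close> by simp
    have "x \<in> Field (A_poset n k)" using xy by (auto simp: Field_def)
    moreover from this have "(Inl (\<mu> \<tau>), x) \<in> A_poset n k"
      using le x by (auto simp: A_poset_iff Field_A_poset)
    moreover have "order_convex (A_poset n k) \<tau>"
      using T[OF that(2)] by (simp add: proper_tube_def tube_def)
    ultimately have "x \<in> \<tau>"
      using \<mu>[OF that(2)] xy unfolding order_convex_def by blast
    then show False using dis xy by auto
  qed
  show ?thesis
  proof (rule acyclic_subset)
    show "acyclic (measure \<mu>)" by (simp add: wf_acyclic)
  qed (use less in \<open>auto\<close>)
qed

lemma tubing_iff:
  "tubing (A_poset n 2) T \<longleftrightarrow> T \<subseteq> tubes (Suc n) - {whole (Suc n)} \<and> laminar T"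
proof -
  let ?R = "{(\<sigma>, \<tau>). \<sigma> \<in> T \<and> \<tau> \<in> T \<and> tube_prec (A_poset n 2) \<sigma> \<tau>}"
  have "acyclic ?R"
    if "\<forall>\<tau>\<in>T. proper_tube (A_poset n 2) \<tau>"
    using that by (intro acyclic_tube_prec) simp
  moreover have "T \<subseteq> tubes (Suc n) - {whole (Suc n)} \<longleftrightarrow> (\<forall>\<tau>\<in>T. proper_tube (A_poset n 2) \<tau>)"
    unfolding subset_iff by (simp add: Ball_def proper_tube_iff)
  ultimately show ?thesis
    unfolding tubing_def laminar_def by argo
qed

section \<open>Face polynomials\<close>

text \<open>A tubing with \<open>j\<close> tubes is a face of dimension \<open>d - j\<close>, and this accounts for every nonempty
  face. So, up to the factor \<open>t ^ d\<close>, the \<open>f\<close>-polynomial counts tubings with weight \<open>1/t\<close> per tube.\<close>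
lemma poly_f_polynomial:
  fixes S :: "'e::euclidean_space set" and t :: complex
  assumes S: "poset_associahedron r S" and fin: "finite {T. tubing r T}"
    and d: "card (Field r) = d + 2" and t: "t \<noteq> 0"
  shows "poly (map_poly of_real (f_polynomial S)) t =
    t ^ d * (\<Sum>T | tubing r T. inverse t ^ card T)"
proof -
  let ?faces = "\<lambda>i. {F. F face_of S \<and> aff_dim F = int i}"
  have dim: "aff_dim S = int d" using S d by (simp add: poset_associahedron_def)
  obtain \<phi> where bij: "bij_betw \<phi> {T. tubing r T} {F. F face_of S \<and> F \<noteq> {}}"
    and \<phi>_dim: "\<And>T. tubing r T \<Longrightarrow> aff_dim (\<phi> T) = int d - int (card T)"
    using S d unfolding poset_associahedron_def by auto
  have card_le: "card T \<le> d" if "tubing r T" for T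
  proof -
    \<comment> \<open>nonempty faces have nonnegative dimension, so truncated subtraction is harmless below\<close>
    have "\<phi> T \<noteq> {}" using bij that by (auto simp: bij_betw_def)
    then have "0 \<le> aff_dim (\<phi> T)" using aff_dim_negative_iff[of "\<phi> T"] by linarith
    then show ?thesis using \<phi>_dim[OF that] by simp
  qed
  have faces: "card (?faces i) = card {T. tubing r T \<and> d - card T = i}" for i
  proof -
    have "?faces i = \<phi> ` {T. tubing r T \<and> d - card T = i}"
    proof (intro equalityI subsetI)
      fix F assume F: "F \<in> ?faces i"
      then have "F \<noteq> {}" by auto
      then have "F \<in> \<phi> ` {T. tubing r T}" using F bij by (auto simp: bij_betw_def)
      then obtain T where "tubing r T" "F = \<phi> T" by auto
      then show "F \<in> \<phi> ` {T. tubing r T \<and> d - card T = i}"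
        using \<phi>_dim[of T] F by auto
    next
      fix F assume "F \<in> \<phi> ` {T. tubing r T \<and> d - card T = i}"
      then obtain T where "tubing r T" "F = \<phi> T" "d - card T = i" by auto
      then show "F \<in> ?faces i" using bij \<phi>_dim[of T] card_le[of T] by (auto simp: bij_betw_def)
    qed
    moreover have "inj_on \<phi> {T. tubing r T \<and> d - card T = i}"
      using bij by (auto simp: bij_betw_def inj_on_def)
    ultimately show ?thesis by (simp add: card_image)
  qed
  have map: "map_poly of_real (f_polynomial S) =
      (\<Sum>i\<le>d. monom (of_nat (card (?faces i)) :: complex) i)"
    unfolding f_polynomial_def dim
    by (rule poly_eqI) (simp add: coeff_map_poly coeff_sum coeff_monom of_real_sum if_distrib cong: if_cong)
  have "poly (map_poly of_real (f_polynomial S)) t = (\<Sum>i\<le>d. of_nat (card (?faces i)) * t ^ i)"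
    unfolding map by (simp add: poly_sum poly_monom)
  also have "\<dots> = (\<Sum>i\<le>d. \<Sum>T | tubing r T \<and> d - card T = i. t ^ (d - card T))"
    unfolding faces by (intro sum.cong refl) simp
  also have "\<dots> = (\<Sum>i\<le>d. \<Sum>T\<in>{T\<in>{T. tubing r T}. d - card T = i}. t ^ (d - card T))"
    by simp
  also have "\<dots> = (\<Sum>T | tubing r T. t ^ (d - card T))"
    by (rule sum.group) (use fin in auto)
  also have "\<dots> = t ^ d * (\<Sum>T | tubing r T. inverse t ^ card T)"
    unfolding sum_distrib_left
    by (intro sum.cong refl) (use card_le t in \<open>simp add: power_diff power_inverse field_simps\<close>)
  finally show ?thesis .
qed

lemma map_poly_of_real_add:
  "map_poly complex_of_real (p + q) = map_poly of_real p + map_poly of_real q"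
  by (rule poly_eqI) (simp add: coeff_map_poly)

lemma poly_map_poly_of_real_shift:
  "poly (map_poly complex_of_real (pcompose h [:1, 1:])) z = poly (map_poly of_real h) (z + 1)"
  by (induction h)
     (simp_all add: pcompose_pCons map_poly_of_real_add map_poly_pCons algebra_simps)

lemma poly_h_polynomial:
  "poly (map_poly complex_of_real (h_polynomial S)) z =
    poly (map_poly complex_of_real (f_polynomial S)) (z - 1)"
proof -
  have "f_polynomial S = pcompose (h_polynomial S) [:1, 1:]"
    using h_polynomial_iff by blast
  then show ?thesis by (simp add: poly_map_poly_of_real_shift)
qed

theorem theorem5p4:
  fixes n :: nat and S :: "'e::euclidean_space set"
  assumes "poset_associahedron (A_poset n 2) S"
  shows "real_rooted (h_polynomial S)"
  unfolding real_rooted_def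
proof (intro allI impI)
  fix z :: complex
  assume root: "poly (map_poly complex_of_real (h_polynomial S)) z = 0"
  let ?U = "tubes (Suc n) - {whole (Suc n)}"
  have tubings: "{T. tubing (A_poset n 2) T} = {T. T \<subseteq> ?U \<and> laminar T}"
    by (simp only: tubing_iff)
  have "finite {T. T \<subseteq> ?U \<and> laminar T}"
    by (rule finite_subset[of _ "Pow ?U"]) (auto simp: finite_tubes)
  then have fin: "finite {T. tubing (A_poset n 2) T}" unfolding tubings .
  show "z \<in> \<real>"
  proof (rule ccontr)
    assume "z \<notin> \<real>"
    then have im: "Im z \<noteq> 0" by (simp add: complex_is_Real_iff)
    define t where "t = z - 1"
    have t: "t \<noteq> 0" using im by (auto simp: t_def)
    have "inverse t \<notin> \<real>"
      using im by (simp add: t_def complex_is_Real_iff)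
    then have "tubing_weight (inverse t) (Suc n) \<noteq> 0"
      by (rule tubing_weight_nonzero)
    moreover have "poly (map_poly of_real (f_polynomial S)) t = t ^ (n + 1) * tubing_weight (inverse t) (Suc n)"
      unfolding tubing_weight_def laminar_weight_def tubings[symmetric]
      by (rule poly_f_polynomial[OF assms fin _ t]) (simp add: card_Field_A_poset)
    ultimately show False
      using root t unfolding poly_h_polynomial t_def[symmetric] by simp
  qed
qed

end
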